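(* Let $X$ be an infinite compact $0$-dimensional Hausdorff space without isolated points. Then the following are equivalent: (i) $C(X)$ is countably degree-$1$ saturated; (ii) $C(X)$ is countably saturated; (iii) the Boolean algebra $CL(X)$ is countably saturated.
   Context: $C(X)$ is the C*-algebra of continuous complex-valued functions on $X$; $CL(X)$ is the Boolean algebra of clopen subsets of $X$; a space is $0$-dimensional if it has a basis of clopen sets. For compact $K\subseteq\mathbb{R}$ and $\epsilon>0$, $(K)_\epsilon=\{x\in\mathbb{R} : d(x,K)<\epsilon\}$; $A_{\le1}$ is the closed unit ball of a C*-algebra $A$. Formulas (continuous logic) are built from norms $\|P(\bar x)\|$ of $*$-polynomials by applying continuous real functions and taking $\sup$ and $\inf$ over variables ranging over the closed unit ball; parameters from $A$ may be substituted for variables. For a collection $\Phi$ of formulas, $A$ is countably $\Phi$-saturated if for every sequence $(\phi_n)_{n\in\mathbb{N}}$ of formulas from $\Phi$ with parameters from $A_{\le 1}$, in variables $(x_k)_{k\in\mathbb{N}}$ (finitely many in each $\phi_n$), and every sequence $(K_n)$ of compact subsets of $\mathbb{R}$, the following are equivalent: (1) there is a sequence $\bar b=(b_k)_{k\in\mathbb{N}}$ in $A_{\le1}$ with $\phi_n^A(\bar b)\in K_n$ for all $n$; (2) for every $\epsilon>0$ and finite $\Delta\subset\mathbb{N}$ there is a sequence $\bar b=(b_k)_{k\in\mathbb{N}}$ in $A_{\le1}$ with $\phi_n^A(\bar b)\in(K_n)_\epsilon$ for all $n\in\Delta$. $A$ is countably saturated if this holds with $\Phi$ the set of all formulas, and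 countably degree-$1$ saturated if it holds with $\Phi$ the set of formulas $\|P(\bar x)\|$ where $P$ is a $*$-polynomial of degree $1$ (a finite sum of terms $ax_kb$, $ax_k^*b$, $a$, with $a,b$ in $A$ or scalars). A Boolean algebra $B$ is countably saturated if every finitely satisfiable countable type (with parameters from $B$) in the first-order language of Boolean algebras is realized in $B$. *)

theory Defs
  imports "HOL-Analysis.Analysis" "HOL-Library.More_List"
begin

class unital_cstar_algebra = real_normed_algebra_1 + banach +
  fixes scaleC :: "complex \<Rightarrow> 'a \<Rightarrow> 'a"
    and adj :: "'a \<Rightarrow> 'a"
  assumes scaleC_add_right: "scaleC c (x + y) = scaleC c x + scaleC c y"
    and scaleC_add_left: "scaleC (c + d) x = scaleC c x + scaleC d x"
    and scaleC_scaleC: "scaleC c (scaleC d x) = scaleC (c * d) x"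
    and scaleC_of_real: "scaleC (of_real r) x = scaleR r x"
    and scaleC_mult_left: "scaleC c x * y = scaleC c (x * y)"
    and scaleC_mult_right: "x * scaleC c y = scaleC c (x * y)"
    and norm_scaleC: "norm (scaleC c x) = cmod c * norm x"
    and adj_adj: "adj (adj x) = x"
    and adj_add: "adj (x + y) = adj x + adj y"
    and adj_scaleC: "adj (scaleC c x) = scaleC (cnj c) (adj x)"
    and adj_mult: "adj (x * y) = adj y * adj x"
    and cstar_identity: "norm (adj x * x) = (norm x)\<^sup>2"

instantiation complex :: unital_cstar_algebra
begin

definition scaleC_complex :: "complex \<Rightarrow> complex \<Rightarrow> complex"
  where "scaleC_complex c x = c * x"

definition adj_complex :: "complex \<Rightarrow> complex"
  where "adj_complex = cnj"

instance
  by standard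
    (auto simp: scaleC_complex_def adj_complex_def algebra_simps norm_mult power2_eq_square
      scaleR_conv_of_real)

end

text \<open>
  The type \<open>'x \<Rightarrow>\<^sub>C complex\<close> of bounded continuous functions, with pointwise operations and the
  supremum norm, is \<open>C(X)\<close> when \<open>X\<close> (the type \<open>'x\<close>) is compact.
\<close>

instance bcontfun :: (topological_space, complete_space) complete_space
proof
  fix f :: "nat \<Rightarrow> ('a, 'b) bcontfun"
  assume "Cauchy f"
  then obtain g where "uniform_limit UNIV f g sequentially"
    using uniformly_convergent_eq_cauchy[of "\<lambda>_. True" f]
    unfolding Cauchy_def uniform_limit_sequentially_iff
    by (metis dist_fun_lt_imp_dist_val_lt)
  from uniform_limit_bcontfunE[OF this sequentially_bot]
  obtain l' where "g = apply_bcontfun l'" "(f \<longlonglongrightarrow> l')" by metis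
  then show "convergent f"
    by (intro convergentI)
qed

instance bcontfun :: (topological_space, banach) banach ..

setup_lifting type_definition_bcontfun

lemma times_cont: "f \<in> bcontfun \<Longrightarrow> g \<in> bcontfun \<Longrightarrow> (\<lambda>x. f x * g x) \<in> bcontfun"
  for f g :: "'a::topological_space \<Rightarrow> 'b::real_normed_algebra"
proof -
  assume f: "f \<in> bcontfun" and g: "g \<in> bcontfun"
  obtain a where a: "\<And>x. norm (f x) \<le> a"
    using f by (auto simp: bcontfun_def bounded_iff)
  obtain b where b: "\<And>x. norm (g x) \<le> b"
    using g by (auto simp: bcontfun_def bounded_iff)
  have "norm (f x * g x) \<le> a * b" for x
    by (rule order_trans[OF norm_mult_ineq mult_mono'[OF a b]]) auto
  then show ?thesis
    using f g by (intro bcontfun_normI) (auto simp: bcontfun_def intro!: continuous_intros)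
qed

instantiation bcontfun :: (topological_space, real_normed_algebra_1) real_normed_algebra_1
begin

lift_definition times_bcontfun :: "('a \<Rightarrow>\<^sub>C 'b) \<Rightarrow> ('a \<Rightarrow>\<^sub>C 'b) \<Rightarrow> ('a \<Rightarrow>\<^sub>C 'b)"
  is "\<lambda>f g x. f x * g x"
  by (rule times_cont)

lift_definition one_bcontfun :: "'a \<Rightarrow>\<^sub>C 'b" is "\<lambda>_. 1"
  by (rule const_bcontfun)

declare times_bcontfun.rep_eq [simp] one_bcontfun.rep_eq [simp]

instance
proof
  fix f g h :: "'a \<Rightarrow>\<^sub>C 'b" and r :: real
  show "f * g * h = f * (g * h)" "(f + g) * h = f * h + g * h" "f * (g + h) = f * g + f * h"
    "1 * f = f" "f * 1 = f"
    "scaleR r f * g = scaleR r (f * g)" "f * scaleR r g = scaleR r (f * g)"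
    by (auto intro!: bcontfun_eqI simp: algebra_simps)
  show "(0 :: 'a \<Rightarrow>\<^sub>C 'b) \<noteq> 1"
  proof
    assume "(0 :: 'a \<Rightarrow>\<^sub>C 'b) = 1"
    then have "apply_bcontfun (0 :: 'a \<Rightarrow>\<^sub>C 'b) undefined = apply_bcontfun 1 undefined" by simp
    then show False by simp
  qed
  show "norm (f * g) \<le> norm f * norm g"
    by (rule norm_bound)
      (auto intro!: order_trans[OF norm_mult_ineq] mult_mono' norm_bounded)
  show "norm (1 :: 'a \<Rightarrow>\<^sub>C 'b) = 1"
    using norm_bounded[of "1 :: 'a \<Rightarrow>\<^sub>C 'b" undefined]
      norm_bound[of "1 :: 'a \<Rightarrow>\<^sub>C 'b" 1] by simp
qed

end

lemma norm_adj: "norm (adj x) = norm x" for x :: "'a::unital_cstar_algebra"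
proof -
  have le: "norm y \<le> norm (adj y)" for y :: 'a
  proof (cases "norm y = 0")
    case False
    have "norm y * norm y \<le> norm (adj y) * norm y"
      using norm_mult_ineq[of "adj y" y] cstar_identity[of y] by (simp add: power2_eq_square)
    then show ?thesis using False by (simp add: mult_le_cancel_right)
  qed simp
  show ?thesis using le[of x] le[of "adj x"] by (simp add: adj_adj)
qed

lemma bounded_linear_adj: "bounded_linear (adj :: 'a::unital_cstar_algebra \<Rightarrow> 'a)"
proof (rule bounded_linear_intro[where K = 1])
  show "adj (scaleR r x) = scaleR r (adj x)" for r and x :: 'a
    using adj_scaleC[of "of_real r" x] by (simp add: scaleC_of_real)
qed (auto simp: adj_add norm_adj)

lemma bounded_linear_scaleC: "bounded_linear (scaleC c :: 'a::unital_cstar_algebra \<Rightarrow> 'a)"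
proof (rule bounded_linear_intro[where K = "cmod c"])
  show "scaleC c (scaleR r x) = scaleR r (scaleC c x)" for r and x :: 'a
    by (simp add: scaleC_scaleC mult.commute flip: scaleC_of_real)
qed (auto simp: scaleC_add_right norm_scaleC)

lemma bounded_linear_comp_cont: "bounded_linear T \<Longrightarrow> f \<in> bcontfun \<Longrightarrow> (\<lambda>x. T (f x)) \<in> bcontfun"
  using bounded_linear_image[of "range f" T]
  by (auto simp: bcontfun_def image_image intro: bounded_linear.continuous_on)

instantiation bcontfun :: (topological_space, unital_cstar_algebra) unital_cstar_algebra
begin

lift_definition scaleC_bcontfun :: "complex \<Rightarrow> ('a \<Rightarrow>\<^sub>C 'b) \<Rightarrow> ('a \<Rightarrow>\<^sub>C 'b)"
  is "\<lambda>c f x. scaleC c (f x)"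
  by (rule bounded_linear_comp_cont[OF bounded_linear_scaleC])

lift_definition adj_bcontfun :: "('a \<Rightarrow>\<^sub>C 'b) \<Rightarrow> ('a \<Rightarrow>\<^sub>C 'b)"
  is "\<lambda>f x. adj (f x)"
  by (rule bounded_linear_comp_cont[OF bounded_linear_adj])

declare scaleC_bcontfun.rep_eq [simp] adj_bcontfun.rep_eq [simp]

instance
proof
  fix f g :: "'a \<Rightarrow>\<^sub>C 'b" and c d :: complex and r :: real
  show "scaleC c (f + g) = scaleC c f + scaleC c g" "scaleC (c + d) f = scaleC c f + scaleC d f"
    "scaleC c (scaleC d f) = scaleC (c * d) f" "scaleC (of_real r) f = scaleR r f"
    "scaleC c f * g = scaleC c (f * g)" "f * scaleC c g = scaleC c (f * g)"
    "adj (adj f) = f" "adj (f + g) = adj f + adj g" "adj (scaleC c f) = scaleC (cnj c) (adj f)"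
    "adj (f * g) = adj g * adj f"
    by (auto intro!: bcontfun_eqI simp: scaleC_add_right scaleC_add_left scaleC_scaleC
        scaleC_of_real scaleC_mult_left scaleC_mult_right adj_adj adj_add adj_scaleC adj_mult)
  show "norm (scaleC c f) = cmod c * norm f"
  proof (rule antisym)
    show le: "norm (scaleC c f) \<le> cmod c * norm f" for c and f :: "'a \<Rightarrow>\<^sub>C 'b"
      by (rule norm_bound) (auto simp: norm_scaleC intro!: mult_left_mono norm_bounded)
    show "cmod c * norm f \<le> norm (scaleC c f)"
    proof (cases "c = 0")
      case False
      have "scaleC (inverse c) (scaleC c f) = f"
        using False scaleC_of_real[of 1] by (auto intro!: bcontfun_eqI simp: scaleC_scaleC)
      then have "norm f \<le> cmod (inverse c) * norm (scaleC c f)"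
        using le[of "inverse c" "scaleC c f"] by simp
      then show ?thesis using False by (simp add: norm_inverse norm_divide field_simps)
    qed simp
  qed
  show "norm (adj f * f) = (norm f)\<^sup>2"
  proof (rule antisym)
    show "norm (adj f * f) \<le> (norm f)\<^sup>2"
      by (rule norm_bound) (auto simp: cstar_identity intro!: power_mono norm_bounded)
    have "norm (apply_bcontfun f x) \<le> sqrt (norm (adj f * f))" for x
      using norm_bounded[of "adj f * f" x] by (auto simp: cstar_identity intro!: real_le_rsqrt)
    then have "norm f \<le> sqrt (norm (adj f * f))"
      by (rule norm_bound)
    then show "(norm f)\<^sup>2 \<le> norm (adj f * f)"
      by (metis norm_ge_zero power_mono real_sqrt_pow2)
  qed
qed

end

lifting_update bcontfun.lifting
lifting_forget bcontfun.lifting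

text \<open>Variables are \<open>x\<^sub>0, x\<^sub>1, x\<^sub>2, \<dots>\<close>.\<close>

datatype (poly_params: 'a) star_poly =
    PVar nat
  | PScalar complex
  | PParam 'a
  | PAdd "'a star_poly" "'a star_poly"
  | PMult "'a star_poly" "'a star_poly"
  | PAdj "'a star_poly"

primrec poly_vars :: "'a star_poly \<Rightarrow> nat set" where
  "poly_vars (PVar k) = {k}"
| "poly_vars (PScalar c) = {}"
| "poly_vars (PParam a) = {}"
| "poly_vars (PAdd p q) = poly_vars p \<union> poly_vars q"
| "poly_vars (PMult p q) = poly_vars p \<union> poly_vars q"
| "poly_vars (PAdj p) = poly_vars p"

primrec poly_value :: "'a star_poly \<Rightarrow> (nat \<Rightarrow> 'a) \<Rightarrow> 'a::unital_cstar_algebra" where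
  "poly_value (PVar k) v = v k"
| "poly_value (PScalar c) v = scaleC c 1"
| "poly_value (PParam a) v = a"
| "poly_value (PAdd p q) v = poly_value p v + poly_value q v"
| "poly_value (PMult p q) v = poly_value p v * poly_value q v"
| "poly_value (PAdj p) v = adj (poly_value p v)"

text \<open>
  Finite sums of terms \<open>a x\<^sub>k b\<close>, \<open>a x\<^sub>k\<^sup>* b\<close> and \<open>a\<close>. The coefficients \<open>a\<close>, \<open>b\<close> are the
  polynomials without variables: since the parameters of a type have norm at most 1, a single
  parameter would not suffice to denote an arbitrary element of the algebra, but its products
  with scalars do.
\<close>

inductive_set degree1_polys :: "'a star_poly set" where
  const: "poly_vars a = {} \<Longrightarrow> a \<in> degree1_polys"
| var: "poly_vars a = {} \<Longrightarrow> poly_vars b = {} \<Longrightarrow>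
    PMult (PMult a (PVar k)) b \<in> degree1_polys"
| adj_var: "poly_vars a = {} \<Longrightarrow> poly_vars b = {} \<Longrightarrow>
    PMult (PMult a (PAdj (PVar k))) b \<in> degree1_polys"
| add: "p \<in> degree1_polys \<Longrightarrow> q \<in> degree1_polys \<Longrightarrow> PAdd p q \<in> degree1_polys"

lemma coefficients_exhaust:
  "\<exists>p. poly_vars p = {} \<and> poly_params p \<subseteq> cball 0 1 \<and> (\<forall>v. poly_value p v = a)"
  for a :: "'a::unital_cstar_algebra"
proof -
  let ?p = "PMult (PScalar (of_real (norm a))) (PParam (a /\<^sub>R norm a))"
  have "poly_value ?p v = a" for v
    by (cases "a = 0") (auto simp: scaleC_of_real)
  then show ?thesis
    by (intro exI[of _ ?p]) (auto simp: field_simps)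
qed

text \<open>
  In \<open>FConn f [\<phi>\<^sub>0, \<dots>, \<phi>\<^sub>n\<^sub>-\<^sub>1]\<close>, the connective is the function
  \<open>(t\<^sub>0, \<dots>, t\<^sub>n\<^sub>-\<^sub>1) \<mapsto> f (t\<^sub>0, \<dots>, t\<^sub>n\<^sub>-\<^sub>1, 0, 0, \<dots>)\<close> on \<open>\<real>\<^sup>n\<close>. For \<open>f\<close> continuous in the product
  topology on \<open>nat \<Rightarrow> real\<close> these are exactly the continuous functions \<open>\<real>\<^sup>n \<rightarrow> \<real>\<close>.
\<close>

datatype (form_params: 'a) cformula =
    FNorm "'a star_poly"
  | FConn "(nat \<Rightarrow> real) \<Rightarrow> real" "'a cformula list"
  | FSup nat "'a cformula"
  | FInf nat "'a cformula"

fun continuous_connectives :: "'a cformula \<Rightarrow> bool" where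
  "continuous_connectives (FNorm p) \<longleftrightarrow> True"
| "continuous_connectives (FConn f \<phi>s) \<longleftrightarrow>
    continuous_on UNIV f \<and> (\<forall>\<phi>\<in>set \<phi>s. continuous_connectives \<phi>)"
| "continuous_connectives (FSup k \<phi>) \<longleftrightarrow> continuous_connectives \<phi>"
| "continuous_connectives (FInf k \<phi>) \<longleftrightarrow> continuous_connectives \<phi>"

fun form_value :: "'a cformula \<Rightarrow> (nat \<Rightarrow> 'a::unital_cstar_algebra) \<Rightarrow> real" where
  "form_value (FNorm p) v = norm (poly_value p v)"
| "form_value (FConn f \<phi>s) v = f (nth_default 0 (map (\<lambda>\<phi>. form_value \<phi> v) \<phi>s))"
| "form_value (FSup k \<phi>) v = (SUP a\<in>cball 0 1. form_value \<phi> (v(k := a)))"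
| "form_value (FInf k \<phi>) v = (INF a\<in>cball 0 1. form_value \<phi> (v(k := a)))"

text \<open>
  The neighbourhood \<open>(K)\<^sub>\<epsilon>\<close> is written as a union of balls rather than with \<open>infdist\<close>, because
  the library's distance to the empty set is 0; here \<open>({})\<^sub>\<epsilon> = {}\<close>.
\<close>

definition countably_saturated_for :: "'a::unital_cstar_algebra cformula set \<Rightarrow> bool" where
  "countably_saturated_for \<Phi> \<longleftrightarrow>
    (\<forall>(\<phi> :: nat \<Rightarrow> 'a cformula) (K :: nat \<Rightarrow> real set).
      (\<forall>n. \<phi> n \<in> \<Phi> \<and> form_params (\<phi> n) \<subseteq> cball 0 1 \<and> compact (K n)) \<longrightarrow>
      ((\<exists>b. (\<forall>k. b k \<in> cball 0 1) \<and> (\<forall>n. form_value (\<phi> n) b \<in> K n)) \<longleftrightarrow>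
       (\<forall>\<epsilon>>0. \<forall>\<Delta>. finite \<Delta> \<longrightarrow>
          (\<exists>b. (\<forall>k. b k \<in> cball 0 1) \<and>
            (\<forall>n\<in>\<Delta>. form_value (\<phi> n) b \<in> (\<Union>y\<in>K n. ball y \<epsilon>))))))"

definition cstar_countably_saturated :: "'a::unital_cstar_algebra itself \<Rightarrow> bool" where
  "cstar_countably_saturated _ \<longleftrightarrow>
    countably_saturated_for {\<phi> :: 'a cformula. continuous_connectives \<phi>}"

definition cstar_countably_degree1_saturated :: "'a::unital_cstar_algebra itself \<Rightarrow> bool" where
  "cstar_countably_degree1_saturated _ \<longleftrightarrow>
    countably_saturated_for (FNorm ` (degree1_polys :: 'a star_poly set))"

datatype 'b ba_term =
    BVar nat
  | BParam 'b
  | BZero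
  | BOne
  | BMeet "'b ba_term" "'b ba_term"
  | BJoin "'b ba_term" "'b ba_term"
  | BCompl "'b ba_term"

primrec ba_value :: "'b ba_term \<Rightarrow> (nat \<Rightarrow> 'b) \<Rightarrow> 'b::boolean_algebra" where
  "ba_value (BVar k) v = v k"
| "ba_value (BParam a) v = a"
| "ba_value BZero v = bot"
| "ba_value BOne v = top"
| "ba_value (BMeet s t) v = inf (ba_value s v) (ba_value t v)"
| "ba_value (BJoin s t) v = sup (ba_value s v) (ba_value t v)"
| "ba_value (BCompl t) v = - ba_value t v"

datatype 'b ba_formula =
    BEq "'b ba_term" "'b ba_term"
  | BNot "'b ba_formula"
  | BAnd "'b ba_formula" "'b ba_formula"
  | BEx nat "'b ba_formula"

primrec ba_holds :: "'b ba_formula \<Rightarrow> (nat \<Rightarrow> 'b::boolean_algebra) \<Rightarrow> bool" where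
  "ba_holds (BEq s t) v \<longleftrightarrow> ba_value s v = ba_value t v"
| "ba_holds (BNot \<phi>) v \<longleftrightarrow> \<not> ba_holds \<phi> v"
| "ba_holds (BAnd \<phi> \<psi>) v \<longleftrightarrow> ba_holds \<phi> v \<and> ba_holds \<psi> v"
| "ba_holds (BEx k \<phi>) v \<longleftrightarrow> (\<exists>a. ba_holds \<phi> (v(k := a)))"

text \<open>As for C*-algebras, types may involve all of the variables \<open>x\<^sub>0, x\<^sub>1, x\<^sub>2, \<dots>\<close>.\<close>

definition ba_countably_saturated :: "'b::boolean_algebra itself \<Rightarrow> bool" where
  "ba_countably_saturated _ \<longleftrightarrow>
    (\<forall>\<Sigma> :: 'b ba_formula set. countable \<Sigma> \<longrightarrow>
      (\<forall>F. finite F \<longrightarrow> F \<subseteq> \<Sigma> \<longrightarrow> (\<exists>v. \<forall>\<phi>\<in>F. ba_holds \<phi> v)) \<longrightarrow>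
      (\<exists>v. \<forall>\<phi>\<in>\<Sigma>. ba_holds \<phi> v))"

typedef (overloaded) 'x clopen = "{S :: 'x::topological_space set. open S \<and> closed S}"
  by (intro exI[of _ "{}"]) simp

setup_lifting type_definition_clopen

instantiation clopen :: (topological_space) boolean_algebra
begin

lift_definition bot_clopen :: "'a clopen" is "{}" by simp
lift_definition top_clopen :: "'a clopen" is UNIV by simp
lift_definition inf_clopen :: "'a clopen \<Rightarrow> 'a clopen \<Rightarrow> 'a clopen" is "(\<inter>)"
  by (simp add: open_Int closed_Int)
lift_definition sup_clopen :: "'a clopen \<Rightarrow> 'a clopen \<Rightarrow> 'a clopen" is "(\<union>)"
  by (simp add: open_Un closed_Un)
lift_definition uminus_clopen :: "'a clopen \<Rightarrow> 'a clopen" is uminus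
  by (simp add: open_Compl closed_Compl)
lift_definition minus_clopen :: "'a clopen \<Rightarrow> 'a clopen \<Rightarrow> 'a clopen" is "(-)"
  by (simp add: open_Diff closed_Diff)
lift_definition less_eq_clopen :: "'a clopen \<Rightarrow> 'a clopen \<Rightarrow> bool" is "(\<subseteq>)" .
lift_definition less_clopen :: "'a clopen \<Rightarrow> 'a clopen \<Rightarrow> bool" is "(\<subset>)" .

instance
  by standard (transfer; auto)+

end

end

theory Submission
  imports Defs "HOL-Library.Diagonal_Subsequence"
begin

text \<open>
  All three saturation properties are shown to be equivalent to a compactness property of the
  clopen sets of \<open>X\<close>, \<open>limit_patterns_realized\<close>. The pattern of a tuple of clopen sets over a sequence
  of parameters says which of the finite Boolean combinations of the sets and parameters are nonempty;
  the property says that limits of finite patterns are patterns of a single sequence of clopen sets.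

  The reason is that both the Boolean algebra \<open>CL(X)\<close> and the algebra \<open>C(X)\<close> eliminate quantifiers.
  As \<open>X\<close> has no isolated points, a nonempty clopen set can be split into any finite number of nonempty
  clopen pieces. Two tuples with the same finite pattern can therefore be extended by matching
  elements (\<open>amalgamation\<close>, \<open>patterns_extend\<close>), and so satisfy the same formulas up to a given
  complexity (\<open>ba_holds_pattern\<close>). For continuous functions the role of the pattern is played by the
  joint range of the tuple and the parameters: if the joint ranges of two tuples have small Hausdorff
  distance, then the two tuples can be extended by matching functions (\<open>near_extend\<close>), and the
  values of a given formula at them differ little (\<open>form_value_local\<close>).

  From patterns to saturation: approximate solutions of a countable type have a subsequence with
  stationary patterns, and a realization of the limit pattern is a solution. For \<open>C(X)\<close> this requires
  coding functions into the unit disk by sequences of clopen sets, through a continuous surjection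
  from the Cantor space to the disk (\<open>limit_patterns_realize_limit\<close>).

  From saturation to patterns: for \<open>CL(X)\<close>, a limit pattern is a countable quantifier-free type. For
  \<open>C(X)\<close> only conditions of degree 1 are available, which cannot express that an element is a
  projection. The clopen sets are therefore found one at a time: each is required to meet or to avoid
  certain known clopen cells, and so is its complement. Such requirements can be written with norms of
  degree-1 polynomials in a function in the unit ball that is to take the values \<open>1\<close> and \<open>-1\<close> at suitable
  places; a clopen set separating these two values is as required (\<open>degree1_saturated_extend\<close>).
\<close>

section \<open>Locally constant functions on a perfect Stone space\<close>

text \<open>
  A compact Hausdorff space with a clopen basis and without isolated points: the Stone space of an
  atomless Boolean algebra.
\<close>

locale perfect_stone_space =
  fixes space_type :: "'x::t2_space itself"
  assumes compact_UNIV: "compact (UNIV :: 'x set)"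
    and clopen_basis: "\<exists>\<B> :: 'x set set. topological_basis \<B> \<and> (\<forall>B\<in>\<B>. open B \<and> closed B)"
    and no_isolated_point: "\<not> (\<exists>x::'x. x isolated_in UNIV)"

definition locally_constant :: "('x::topological_space \<Rightarrow> 'i) \<Rightarrow> bool" where
  "locally_constant f \<longleftrightarrow> (\<forall>A. open (f -` A))"

lemma locally_constant_comp: "locally_constant f \<Longrightarrow> locally_constant (\<lambda>x. g (f x))"
  unfolding locally_constant_def
proof
  fix A
  assume "\<forall>A. open (f -` A)"
  then have "open (f -` (g -` A))" ..
  then show "open ((\<lambda>x. g (f x)) -` A)" by (simp add: vimage_def)
qed

lemma locally_constant_Pair:
  assumes f: "locally_constant f" and g: "locally_constant g"
  shows "locally_constant (\<lambda>x. (f x, g x))"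
  unfolding locally_constant_def
proof
  fix A
  have "(\<lambda>x. (f x, g x)) -` A = (\<Union>(a, b)\<in>A. f -` {a} \<inter> g -` {b})" by auto
  then show "open ((\<lambda>x. (f x, g x)) -` A)"
    using f g by (auto simp: locally_constant_def intro!: open_UN open_Int)
qed

lemma locally_constant_mem:
  assumes "open U" "closed U"
  shows "locally_constant (\<lambda>x. x \<in> U)"
  unfolding locally_constant_def
proof
  fix A :: "bool set"
  have "x \<in> (\<lambda>x. x \<in> U) -` A \<longleftrightarrow>
      x \<in> (if True \<in> A then U else {}) \<union> (if False \<in> A then - U else {})" for x
    by (cases "x \<in> U") simp_all
  then have "(\<lambda>x. x \<in> U) -` A = (if True \<in> A then U else {}) \<union> (if False \<in> A then - U else {})"
    by blast
  then show "open ((\<lambda>x. x \<in> U) -` A)"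
    using assms by (auto intro: open_Compl)
qed

lemma locally_constant_Collect:
  assumes "finite I" "\<And>i. i \<in> I \<Longrightarrow> open (U i) \<and> closed (U i)"
  shows "locally_constant (\<lambda>x. {i \<in> I. x \<in> U i})"
  using assms
proof (induction I)
  case empty
  then show ?case by (simp add: locally_constant_def vimage_def)
next
  case (insert i I)
  have "locally_constant (\<lambda>x. (x \<in> U i, {i \<in> I. x \<in> U i}))"
    using insert by (intro locally_constant_Pair locally_constant_mem) auto
  then have "locally_constant (\<lambda>x. (\<lambda>(b, S). if b then insert i S else S) (x \<in> U i, {i \<in> I. x \<in> U i}))"
    by (rule locally_constant_comp)
  moreover have "(\<lambda>(b, S). if b then insert i S else S) (x \<in> U i, {i \<in> I. x \<in> U i})
      = {j \<in> insert i I. x \<in> U j}" for x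
    by auto
  ultimately show ?case by simp
qed

lemma locally_constant_clopen:
  assumes "locally_constant f"
  shows "open {x. P (f x)}" "closed {x. P (f x)}"
proof -
  have "open (f -` {i. P i})" "open (f -` {i. \<not> P i})"
    using assms unfolding locally_constant_def by blast+
  then show "open {x. P (f x)}" "closed {x. P (f x)}"
    by (simp_all add: closed_def vimage_def Compl_eq)
qed

lemma locally_constant_continuous:
  fixes g :: "'i \<Rightarrow> 'b::topological_space"
  shows "locally_constant f \<Longrightarrow> continuous_on UNIV (\<lambda>x. g (f x))"
  using locally_constant_comp[of f g]
  by (auto simp: continuous_on_open_vimage locally_constant_def)

context perfect_stone_space
begin

lemma clopen_neighbourhood:
  fixes x :: 'x
  assumes "open U" "x \<in> U"
  obtains V where "open V" "closed V" "x \<in> V" "V \<subseteq> U"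
proof -
  obtain \<B> :: "'x set set" where \<B>: "topological_basis \<B>" "\<And>B. B \<in> \<B> \<Longrightarrow> open B \<and> closed B"
    using clopen_basis by blast
  obtain V where "V \<in> \<B>" "x \<in> V" "V \<subseteq> U"
    using topological_basisE[OF \<B>(1) assms] .
  then show ?thesis using \<B>(2) that by blast
qed

lemma finite_range_locally_constant:
  fixes f :: "'x \<Rightarrow> 'i"
  assumes "locally_constant f"
  shows "finite (range f)"
proof -
  have op: "open (f -` {i})" for i
    using assms unfolding locally_constant_def by blast
  have cover: "UNIV \<subseteq> (\<Union>i\<in>range f. f -` {i})" by blast
  obtain C where "finite C" "UNIV \<subseteq> (\<Union>i\<in>C. f -` {i})"
    using compactE_image[OF compact_UNIV op cover] .
  then have "range f \<subseteq> C" by auto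
  then show ?thesis using \<open>finite C\<close> finite_subset by blast
qed

text \<open>
  This is where the absence of isolated points enters: a nonempty open set contains two points, so it
  splits into a nonempty clopen piece and a nonempty open rest, and the splitting can be repeated.
\<close>

lemma locally_constant_onto:
  fixes U :: "'x set"
  assumes "finite I" "I \<noteq> {}" "open U" "U \<noteq> {}"
  shows "\<exists>h. (\<forall>A. open (U \<inter> h -` A)) \<and> h ` U = I"
  using assms
proof (induction I arbitrary: U rule: finite_ne_induct)
  case (singleton i)
  have "open (U \<inter> (\<lambda>_. i) -` A)" for A
    using singleton.prems(1) by (cases "i \<in> A") auto
  then show ?case
    using singleton.prems(2) by (intro exI[of _ "\<lambda>_. i"]) auto
next
  case (insert i I)
  obtain x where x: "x \<in> U" using insert.prems by auto
  have "U \<noteq> {x}"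
    using no_isolated_point insert.prems(1) by (auto simp: isolated_in_def)
  then obtain y where y: "y \<in> U" "y \<noteq> x" using x by auto
  obtain W where W: "open W" "x \<in> W" "y \<notin> W"
    using separation_t1[of x y] y(2) by metis
  obtain V where V: "open V" "closed V" "x \<in> V" "V \<subseteq> U \<inter> W"
    using clopen_neighbourhood[of "U \<inter> W" x] W x insert.prems(1) by (metis IntI open_Int)
  have "open (U - V)" "U - V \<noteq> {}"
    using V y W insert.prems(1) by auto
  then obtain h where h: "\<And>A. open ((U - V) \<inter> h -` A)" "h ` (U - V) = I"
    using insert.IH by metis
  let ?h = "\<lambda>z. if z \<in> V then i else h z"
  have "open (U \<inter> ?h -` A)" for A
  proof -
    have "U \<inter> ?h -` A = ((U - V) \<inter> h -` A) \<union> (if i \<in> A then V else {})"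
      using V(4) by (auto split: if_splits)
    then show ?thesis using h(1)[of A] V(1) by auto
  qed
  moreover have "?h ` U = insert i I"
  proof -
    have UV: "V \<union> (U - V) = U" using V by auto
    have "?h ` U = ?h ` V \<union> ?h ` (U - V)" unfolding image_Un[symmetric] UV ..
    also have "?h ` V = {i}" using V(3) by auto
    also have "?h ` (U - V) = h ` (U - V)" by auto
    finally show ?thesis using h(2) by simp
  qed
  ultimately show ?case by blast
qed

text \<open>
  The combinatorial core of both back-and-forth arguments below. Think of \<open>f\<close> and \<open>g\<close> as finite
  descriptions of two configurations in \<open>X\<close>, and of \<open>R\<close> as compatibility of descriptions. Each cell
  of \<open>g\<close> is cut into as many nonempty clopen pieces as it has compatible values of \<open>f\<close>; relabelling
  the pieces with these values transports the information carried by \<open>f\<close> to the side of \<open>g\<close>, and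
  every compatible pair of labels is attained at some point.
\<close>

lemma amalgamation:
  fixes f :: "'x \<Rightarrow> 'i" and g :: "'x \<Rightarrow> 'j"
  assumes f: "locally_constant f" and g: "locally_constant g"
    and total: "\<And>y. \<exists>x. R (f x) (g y)"
  obtains h :: "'x \<Rightarrow> 'i" where "locally_constant h" "range h \<subseteq> range f" "\<And>y. R (h y) (g y)"
    "\<And>x y. R (f x) (g y) \<Longrightarrow> \<exists>y'. g y' = g y \<and> h y' = f x"
proof -
  define L where "L j = {i \<in> range f. R i j}" for j
  have "\<exists>h. (\<forall>A. open (g -` {g y} \<inter> h -` A)) \<and> h ` (g -` {g y}) = L (g y)" for y
  proof (rule locally_constant_onto)
    show "finite (L (g y))" using finite_range_locally_constant[OF f] by (simp add: L_def)
    show "L (g y) \<noteq> {}" using total[of y] by (auto simp: L_def)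
    show "open (g -` {g y})" using g unfolding locally_constant_def by blast
    show "g -` {g y} \<noteq> {}" by blast
  qed
  then have "\<forall>j\<in>range g. \<exists>h. (\<forall>A. open (g -` {j} \<inter> h -` A)) \<and> h ` (g -` {j}) = L j"
    by blast
  from bchoice[OF this] obtain H
    where "\<forall>j\<in>range g. (\<forall>A. open (g -` {j} \<inter> H j -` A)) \<and> H j ` (g -` {j}) = L j" ..
  then have H: "open (g -` {g y} \<inter> H (g y) -` A)" "H (g y) ` (g -` {g y}) = L (g y)" for y A
    by simp_all
  have mem: "H (g y) y \<in> L (g y)" for y
  proof -
    have "H (g y) y \<in> H (g y) ` (g -` {g y})" by (intro imageI) simp
    then show ?thesis unfolding H(2) .
  qed
  show ?thesis
  proof (rule that)
    have "(\<lambda>y. H (g y) y) -` A = (\<Union>y. g -` {g y} \<inter> H (g y) -` A)" for A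
      by fastforce
    then show "locally_constant (\<lambda>y. H (g y) y)"
      unfolding locally_constant_def using H(1) by (metis (no_types, lifting) open_UN)
    show "range (\<lambda>y. H (g y) y) \<subseteq> range f" "R (H (g y) y) (g y)" for y
      using mem by (auto simp: L_def)
    fix x y
    assume "R (f x) (g y)"
    then have "f x \<in> H (g y) ` (g -` {g y})"
      unfolding H(2) by (simp add: L_def)
    then obtain y' where "g y' = g y" "f x = H (g y) y'" by (elim imageE) simp
    then show "\<exists>y'. g y' = g y \<and> H (g y') y' = f x" by (intro exI[of _ y']) simp
  qed
qed

text \<open>
  Compactness gives a finite clopen partition on whose cells all functions in \<open>F\<close> vary little; \<open>f\<close>
  sends each cell to one of its points. Choosing step functions \<open>u \<circ> f\<close> of this form, with one map \<open>f\<close> of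
  the domain for all \<open>u\<close>, keeps the values of different functions at a point together.
\<close>

lemma locally_constant_retraction:
  fixes F :: "('x \<Rightarrow> 'b::metric_space) set"
  assumes "finite F" and cont: "\<And>u. u \<in> F \<Longrightarrow> continuous_on UNIV u" and "\<delta> > 0"
  obtains f :: "'x \<Rightarrow> 'x" where "locally_constant f" "\<And>u x. u \<in> F \<Longrightarrow> dist (u (f x)) (u x) < \<delta>"
proof -
  have "\<exists>V. open V \<and> closed V \<and> x \<in> V \<and> (\<forall>u\<in>F. \<forall>y\<in>V. dist (u y) (u x) < \<delta> / 2)" for x
  proof -
    define U where "U = (\<Inter>u\<in>F. {y. dist (u y) (u x) < \<delta> / 2})"
    have "open {y. dist (u y) (u x) < \<delta> / 2}" if "u \<in> F" for u
      using cont[OF that] by (intro open_Collect_less continuous_intros)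
    then have "open U"
      unfolding U_def using \<open>finite F\<close> by (intro open_INT) simp_all
    moreover have "x \<in> U" using \<open>\<delta> > 0\<close> by (simp add: U_def)
    ultimately obtain V where V: "open V" "closed V" "x \<in> V" "V \<subseteq> U"
      by (rule clopen_neighbourhood)
    have "\<forall>u\<in>F. \<forall>y\<in>V. dist (u y) (u x) < \<delta> / 2"
      using V(4) unfolding U_def by blast
    with V show ?thesis by blast
  qed
  then have "\<forall>x. \<exists>V. open V \<and> closed V \<and> x \<in> V \<and> (\<forall>u\<in>F. \<forall>y\<in>V. dist (u y) (u x) < \<delta> / 2)"
    by simp
  from choice[OF this] obtain V
    where "\<forall>x. open (V x) \<and> closed (V x) \<and> x \<in> V x \<and> (\<forall>u\<in>F. \<forall>y\<in>V x. dist (u y) (u x) < \<delta> / 2)" ..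
  then have V: "open (V x)" "closed (V x)" "x \<in> V x"
      "\<forall>u\<in>F. \<forall>y\<in>V x. dist (u y) (u x) < \<delta> / 2" for x
    by simp_all
  have cover: "UNIV \<subseteq> (\<Union>x\<in>UNIV. V x)" using V(3) by blast
  obtain C where C: "finite C" "UNIV \<subseteq> (\<Union>x\<in>C. V x)"
    using compactE_image[OF compact_UNIV V(1) cover] .
  let ?cell = "\<lambda>y. {x \<in> C. y \<in> V x}"
  define rep where "rep S = (SOME y. ?cell y = S)" for S
  have cell_rep: "?cell (rep (?cell y)) = ?cell y" for y
    unfolding rep_def by (rule someI[where P = "\<lambda>z. ?cell z = ?cell y" and x = y]) (rule refl)
  show ?thesis
  proof (rule that)
    show "locally_constant (\<lambda>y. rep (?cell y))"
      using C(1) V(1,2) by (intro locally_constant_comp[where f = ?cell and g = rep] locally_constant_Collect) simp_all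
    fix u y assume u: "u \<in> F"
    obtain x where x: "x \<in> C" "y \<in> V x" using C(2) by blast
    then have "x \<in> ?cell y" by simp
    then have "x \<in> ?cell (rep (?cell y))" by (simp only: cell_rep)
    then have "rep (?cell y) \<in> V x" by simp
    then have "dist (u (rep (?cell y))) (u x) < \<delta> / 2" "dist (u y) (u x) < \<delta> / 2"
      using V(4) u x by blast+
    then show "dist (u (rep (?cell y))) (u y) < \<delta>"
      by (rule dist_triangle_half_l)
  qed
qed

end

section \<open>Finite patterns of clopen sets and their limits\<close>

text \<open>
  The address of a point records to which of the sets \<open>v\<^sub>i\<close> with \<open>i \<in> I\<close> it belongs. The pattern of \<open>v\<close>
  over the parameters \<open>p\<close> is the set of the addresses that occur; it says which of the finite
  Boolean combinations of the \<open>v\<^sub>i\<close> and \<open>p\<^sub>j\<close> are nonempty, i.e. it is a quantifier-free type.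
\<close>

definition address :: "nat set \<Rightarrow> (nat \<Rightarrow> 'x::topological_space clopen) \<Rightarrow> 'x \<Rightarrow> nat set" where
  "address I v x = {i \<in> I. x \<in> Rep_clopen (v i)}"

definition patterns :: "(nat \<Rightarrow> 'x::topological_space clopen) \<Rightarrow> nat set \<Rightarrow> nat set \<Rightarrow>
    (nat \<Rightarrow> 'x clopen) \<Rightarrow> (nat set \<times> nat set) set" where
  "patterns p I J v = range (\<lambda>x. (address I v x, address J p x))"

lemma address_restrict: "I \<subseteq> I' \<Longrightarrow> address I v x = I \<inter> address I' v x"
  by (auto simp: address_def)

lemma address_cong: "(\<And>i. i \<in> I \<Longrightarrow> v i = w i) \<Longrightarrow> address I v x = address I w x"
  by (auto simp: address_def)

lemma address_eqD:
  "address I v x = address I w y \<Longrightarrow> i \<in> I \<Longrightarrow> x \<in> Rep_clopen (v i) \<longleftrightarrow> y \<in> Rep_clopen (w i)"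
  unfolding address_def by blast

lemma patterns_cong: "(\<And>i. i \<in> I \<Longrightarrow> v i = w i) \<Longrightarrow> patterns p I J v = patterns p I J w"
  using address_cong[of I v w] by (simp add: patterns_def)

lemma address_fun_upd:
  "address (insert k I) (v(k := a)) x
    = (if x \<in> Rep_clopen a then insert k (address I v x) else address I v x - {k})"
  by (auto simp: address_def)

lemma locally_constant_address: "finite I \<Longrightarrow> locally_constant (address I v)"
  unfolding address_def[abs_def] using Rep_clopen
  by (intro locally_constant_Collect) auto

lemma patterns_mono:
  assumes "patterns p I' J' v = patterns p I' J' w" "I \<subseteq> I'" "J \<subseteq> J'"
  shows "patterns p I J v = patterns p I J w"
proof -
  have "patterns p I J u = (\<lambda>(S, T). (I \<inter> S, J \<inter> T)) ` patterns p I' J' u" for u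
    using assms(2,3) by (simp add: patterns_def image_image address_restrict)
  then show ?thesis using assms(1) by simp
qed

lemma patterns_eqD:
  assumes "patterns p I J v = patterns p I J w"
  shows "\<exists>y. address I w y = address I v x \<and> address J p y = address J p x"
proof -
  have "(address I v x, address J p x) \<in> patterns p I J w"
    using assms[symmetric] by (auto simp: patterns_def)
  then show ?thesis by (auto simp: patterns_def)
qed

text \<open>
  The back-and-forth step for clopen sets: a new set on one side is matched by a new set on the other
  side, because the membership bit of the new set can be transported by amalgamation.
\<close>

lemma (in perfect_stone_space) patterns_extend:
  fixes v w p :: "nat \<Rightarrow> 'x clopen"
  assumes eq: "patterns p I J v = patterns p I J w" and fin: "finite I" "finite J"
  shows "\<exists>b. patterns p (insert k I) J (v(k := a)) = patterns p (insert k I) J (w(k := b))"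
proof -
  let ?f = "\<lambda>x. ((address I v x, address J p x), x \<in> Rep_clopen a)"
  let ?g = "\<lambda>y. (address I w y, address J p y)"
  have "locally_constant ?f" "locally_constant ?g"
    using fin Rep_clopen[of a]
    by (auto intro!: locally_constant_Pair locally_constant_address locally_constant_mem)
  moreover have "\<exists>x. fst (?f x) = ?g y" for y
    using patterns_eqD[OF eq[symmetric], of y] by auto
  ultimately obtain h where h: "locally_constant h" "range h \<subseteq> range ?f" "\<And>y. fst (h y) = ?g y"
      "\<And>x y. fst (?f x) = ?g y \<Longrightarrow> \<exists>y'. ?g y' = ?g y \<and> h y' = ?f x"
    by (rule amalgamation[where R = "\<lambda>i j. fst i = j" and f = ?f and g = ?g]) blast
  define b where "b = Abs_clopen {y. snd (h y)}"
  have b: "y \<in> Rep_clopen b \<longleftrightarrow> snd (h y)" for y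
    using locally_constant_clopen[OF h(1), of snd] by (simp add: b_def Abs_clopen_inverse)
  have v: "(address (insert k I) (v(k := a)) x, address J p x)
      = (\<lambda>((S, T), e). (if e then insert k S else S - {k}, T)) (?f x)" for x
    by (simp add: address_fun_upd)
  have w: "(address (insert k I) (w(k := b)) y, address J p y)
      = (\<lambda>((S, T), e). (if e then insert k S else S - {k}, T)) (h y)" for y
    using h(3)[of y] by (cases "h y") (auto simp: address_fun_upd b)
  have "?f x \<in> range h" for x
  proof -
    obtain y where "fst (?f x) = ?g y"
      using patterns_eqD[OF eq, of x] by auto
    then obtain y' where "h y' = ?f x" using h(4)[of x y] by blast
    then show ?thesis by (metis rangeI)
  qed
  then have eq_range: "range h = range ?f" using h(2) by blast
  let ?t = "\<lambda>((S, T), e). (if e then insert k S else S - {k}, T)"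
  have "patterns p (insert k I) J (v(k := a)) = ?t ` range ?f"
    unfolding patterns_def v image_image ..
  also have "\<dots> = patterns p (insert k I) J (w(k := b))"
    unfolding patterns_def w eq_range[symmetric] image_image ..
  finally show ?thesis ..
qed

text \<open>
  The property of \<open>X\<close> with which the three saturation properties are compared. It is a compactness
  property: the tuples \<open>w m\<close> converge in the sense of patterns, and the limit has to be attained.
\<close>

definition limit_patterns_realized :: "'x::topological_space itself \<Rightarrow> bool" where
  "limit_patterns_realized _ \<longleftrightarrow>
    (\<forall>(p :: nat \<Rightarrow> 'x clopen) (w :: nat \<Rightarrow> nat \<Rightarrow> 'x clopen).
      (\<forall>n m. n \<le> m \<longrightarrow> patterns p {..<n} {..<n} (w m) = patterns p {..<n} {..<n} (w n)) \<longrightarrow>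
      (\<exists>v. \<forall>n. patterns p {..<n} {..<n} v = patterns p {..<n} {..<n} (w n)))"

lemma stabilizing_subsequence:
  fixes F :: "nat \<Rightarrow> nat \<Rightarrow> 'a"
  assumes "\<And>n. finite (range (F n))"
  obtains r where "strict_mono r" "\<And>n m. n \<le> m \<Longrightarrow> F n (r m) = F n (r n)"
proof -
  have "\<exists>r :: nat \<Rightarrow> nat. strict_mono r \<and> (\<exists>c. \<forall>m. F n ((s \<circ> r) m) = c)" for n and s :: "nat \<Rightarrow> nat"
  proof -
    have "finite ((\<lambda>m. F n (s m)) ` UNIV)"
      by (rule finite_subset[OF _ assms[of n]]) blast
    from pigeonhole_infinite[OF infinite_UNIV_nat this]
    obtain m0 where "infinite {m. F n (s m) = F n (s m0)}" by auto
    from infinite_enumerate[OF this]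
    obtain r :: "nat \<Rightarrow> nat" where "strict_mono r" "\<forall>m. r m \<in> {m. F n (s m) = F n (s m0)}" by blast
    then show ?thesis by (intro exI[of _ r]) simp
  qed
  then interpret subseqs "\<lambda>n s. \<exists>c. \<forall>m. F n (s m) = c"
    by unfold_locales simp
  \<comment> \<open>the diagonal sequence is a subsequence of the \<open>n\<close>-th one only from index \<open>Suc n\<close> on,
    which is why the index is shifted by one below\<close>
  have const: "\<exists>c. \<forall>m. F n ((diagseq \<circ> (+) (Suc n)) m) = c" for n
    by (rule diagseq_holds) (metis comp_apply)
  show ?thesis
  proof (rule that[of "\<lambda>m. diagseq (Suc m)"])
    show "strict_mono (\<lambda>m. diagseq (Suc m))"
      using subseq_diagseq by (simp add: strict_mono_def)
    fix n m :: nat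
    assume "n \<le> m"
    obtain c where c: "\<And>k. F n (diagseq (Suc n + k)) = c" using const[of n] by auto
    show "F n (diagseq (Suc m)) = F n (diagseq (Suc n))"
      using c[of "m - n"] c[of 0] \<open>n \<le> m\<close> by simp
  qed
qed

text \<open>
  There are only finitely many patterns at each level, so every sequence of tuples has a subsequence
  with stationary patterns.
\<close>

lemma limit_patterns_realizedE:
  fixes p :: "nat \<Rightarrow> 'x::topological_space clopen" and w :: "nat \<Rightarrow> nat \<Rightarrow> 'x clopen"
  assumes "limit_patterns_realized TYPE('x)"
  obtains v r where "strict_mono r"
    "\<And>n m. n \<le> m \<Longrightarrow> patterns p {..<n} {..<n} v = patterns p {..<n} {..<n} (w (r m))"
proof -
  let ?F = "\<lambda>n m. patterns p {..<n} {..<n} (w m)"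
  have "range (?F n) \<subseteq> Pow (Pow {..<n} \<times> Pow {..<n})" for n
    by (auto simp: patterns_def address_def)
  then have fin: "finite (range (?F n))" for n
    by (rule finite_subset) simp
  obtain r where r: "strict_mono r" "\<And>n m. n \<le> m \<Longrightarrow> ?F n (r m) = ?F n (r n)"
    by (rule stabilizing_subsequence[of ?F, OF fin]) (rule that)
  have "\<exists>v. \<forall>n. patterns p {..<n} {..<n} v = ?F n (r n)"
    using assms unfolding limit_patterns_realized_def
    by (elim allE[where x = p] allE[where x = "\<lambda>m. w (r m)"] impE) (use r(2) in blast)+
  then obtain v where "\<forall>n. patterns p {..<n} {..<n} v = ?F n (r n)" ..
  then have v: "patterns p {..<n} {..<n} v = ?F n (r n)" for n by (rule spec)
  show ?thesis
  proof (rule that)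
    show "strict_mono r" by (rule r(1))
    show "patterns p {..<n} {..<n} v = patterns p {..<n} {..<n} (w (r m))" if "n \<le> m" for n m
      unfolding v r(2)[OF that] ..
  qed
qed

section \<open>Limit patterns and saturation of the clopen algebra\<close>

text \<open>
  Whether a point belongs to the value of a term depends only on finitely many coordinates of its
  address. Here and below, `finitely many' is expressed by quantifying over almost all levels \<open>n\<close>, so
  that the levels required by subterms and subformulas combine without bookkeeping.
\<close>

lemma ba_value_local:
  fixes t :: "'x::topological_space clopen ba_term"
  assumes "set_ba_term t \<subseteq> range p"
  shows "\<forall>\<^sub>F n in sequentially. \<forall>v w x y.
    address {..<n} v x = address {..<n} w y \<longrightarrow> address {..<n} p x = address {..<n} p y \<longrightarrow>
    (x \<in> Rep_clopen (ba_value t v) \<longleftrightarrow> y \<in> Rep_clopen (ba_value t w))"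
  using assms
proof (induction t)
  case (BVar k)
  show ?case
    using eventually_gt_at_top[of k]
  proof eventually_elim
    case (elim n)
    show ?case
      unfolding ba_value.simps
      by (intro allI impI, rule address_eqD, assumption) (use elim in simp)
  qed
next
  case (BParam a)
  then obtain k where a: "a = p k" by auto
  show ?case
    using eventually_gt_at_top[of k]
  proof eventually_elim
    case (elim n)
    show ?case
      unfolding ba_value.simps a
      by (intro allI impI, rule address_eqD[of "{..<n}" p _ p], assumption) (use elim in simp)
  qed
next
  case BZero
  then show ?case by (simp add: bot_clopen.rep_eq)
next
  case BOne
  then show ?case by (simp add: top_clopen.rep_eq)
next
  case (BMeet s t)
  then have "set_ba_term s \<subseteq> range p" "set_ba_term t \<subseteq> range p" by simp_all
  from BMeet.IH(1)[OF this(1)] BMeet.IH(2)[OF this(2)] show ?case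
  proof eventually_elim
    case (elim n)
    show ?case
    proof (intro allI impI)
      fix v w x y
      assume xy: "address {..<n} v x = address {..<n} w y" "address {..<n} p x = address {..<n} p y"
      show "x \<in> Rep_clopen (ba_value (BMeet s t) v) \<longleftrightarrow> y \<in> Rep_clopen (ba_value (BMeet s t) w)"
        using elim(1)[rule_format, OF xy] elim(2)[rule_format, OF xy] by (simp add: inf_clopen.rep_eq)
    qed
  qed
next
  case (BJoin s t)
  then have "set_ba_term s \<subseteq> range p" "set_ba_term t \<subseteq> range p" by simp_all
  from BJoin.IH(1)[OF this(1)] BJoin.IH(2)[OF this(2)] show ?case
  proof eventually_elim
    case (elim n)
    show ?case
    proof (intro allI impI)
      fix v w x y
      assume xy: "address {..<n} v x = address {..<n} w y" "address {..<n} p x = address {..<n} p y"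
      show "x \<in> Rep_clopen (ba_value (BJoin s t) v) \<longleftrightarrow> y \<in> Rep_clopen (ba_value (BJoin s t) w)"
        using elim(1)[rule_format, OF xy] elim(2)[rule_format, OF xy] by (simp add: sup_clopen.rep_eq)
    qed
  qed
next
  case (BCompl t)
  then have "set_ba_term t \<subseteq> range p" by simp
  from BCompl.IH[OF this] show ?case
  proof eventually_elim
    case (elim n)
    show ?case
    proof (intro allI impI)
      fix v w x y
      assume xy: "address {..<n} v x = address {..<n} w y" "address {..<n} p x = address {..<n} p y"
      show "x \<in> Rep_clopen (ba_value (BCompl t) v) \<longleftrightarrow> y \<in> Rep_clopen (ba_value (BCompl t) w)"
        using elim[rule_format, OF xy] by (simp add: uminus_clopen.rep_eq)
    qed
  qed
qed

context perfect_stone_space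
begin

text \<open>
  Quantifier elimination for atomless Boolean algebras, in semantic form: the truth of a formula is
  determined by a finite pattern. Quantifiers are handled by the back-and-forth step.
\<close>

lemma ba_holds_pattern:
  fixes \<phi> :: "'x clopen ba_formula"
  assumes "set_ba_formula \<phi> \<subseteq> range p"
  shows "\<forall>\<^sub>F n in sequentially. \<forall>v w. patterns p {..<n} {..<n} v = patterns p {..<n} {..<n} w \<longrightarrow>
    (ba_holds \<phi> v \<longleftrightarrow> ba_holds \<phi> w)"
  using assms
proof (induction \<phi>)
  case (BEq s t)
  then have "set_ba_term s \<subseteq> range p" "set_ba_term t \<subseteq> range p" by simp_all
  from ba_value_local[OF this(1)] ba_value_local[OF this(2)] show ?case
  proof eventually_elim
    case (elim n)
    have imp: "ba_value s w = ba_value t w"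
      if eq: "patterns p {..<n} {..<n} v = patterns p {..<n} {..<n} w"
        and st: "ba_value s v = ba_value t v" for v w
    proof -
      have "y \<in> Rep_clopen (ba_value s w) \<longleftrightarrow> y \<in> Rep_clopen (ba_value t w)" for y
      proof -
        obtain x where x: "address {..<n} v x = address {..<n} w y" "address {..<n} p x = address {..<n} p y"
          using patterns_eqD[OF eq[symmetric], of y] by (elim exE conjE)
        show ?thesis
          using elim(1)[rule_format, OF x] elim(2)[rule_format, OF x] unfolding st by (rule subst)
      qed
      then have "Rep_clopen (ba_value s w) = Rep_clopen (ba_value t w)" by (rule set_eqI)
      then show ?thesis unfolding Rep_clopen_inject .
    qed
    show ?case
    proof (intro allI impI)
      fix v w
      assume eq: "patterns p {..<n} {..<n} v = patterns p {..<n} {..<n} w"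
      show "ba_holds (BEq s t) v \<longleftrightarrow> ba_holds (BEq s t) w"
        unfolding ba_holds.simps using imp[OF eq] imp[OF eq[symmetric]] by (rule iffI)
    qed
  qed
next
  case (BNot \<phi>)
  then have "set_ba_formula \<phi> \<subseteq> range p" by simp
  from BNot.IH[OF this] show ?case
  proof eventually_elim
    case (elim n)
    show ?case
    proof (intro allI impI)
      fix v w
      assume eq: "patterns p {..<n} {..<n} v = patterns p {..<n} {..<n} w"
      show "ba_holds (BNot \<phi>) v \<longleftrightarrow> ba_holds (BNot \<phi>) w"
        using elim[rule_format, OF eq] by simp
    qed
  qed
next
  case (BAnd \<phi> \<psi>)
  then have "set_ba_formula \<phi> \<subseteq> range p" "set_ba_formula \<psi> \<subseteq> range p" by simp_all
  from BAnd.IH(1)[OF this(1)] BAnd.IH(2)[OF this(2)] show ?case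
  proof eventually_elim
    case (elim n)
    show ?case
    proof (intro allI impI)
      fix v w
      assume eq: "patterns p {..<n} {..<n} v = patterns p {..<n} {..<n} w"
      show "ba_holds (BAnd \<phi> \<psi>) v \<longleftrightarrow> ba_holds (BAnd \<phi> \<psi>) w"
        using elim(1)[rule_format, OF eq] elim(2)[rule_format, OF eq] by simp
    qed
  qed
next
  case (BEx k \<phi>)
  then have "set_ba_formula \<phi> \<subseteq> range p" by simp
  from BEx.IH[OF this] eventually_gt_at_top[of k] show ?case
  proof eventually_elim
    case (elim n)
    have k: "insert k {..<n} = {..<n}" using elim(2) by (simp add: insert_absorb)
    have imp: "ba_holds (BEx k \<phi>) w"
      if eq: "patterns p {..<n} {..<n} v = patterns p {..<n} {..<n} w"
        and ex: "ba_holds (BEx k \<phi>) v" for v w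
    proof -
      obtain a where a: "ba_holds \<phi> (v(k := a))" using ex unfolding ba_holds.simps ..
      obtain b where b: "patterns p {..<n} {..<n} (v(k := a)) = patterns p {..<n} {..<n} (w(k := b))"
        using patterns_extend[OF eq finite_lessThan finite_lessThan, of k a] unfolding k ..
      have "ba_holds \<phi> (w(k := b))" using elim(1)[rule_format, OF b] a by simp
      then show ?thesis unfolding ba_holds.simps ..
    qed
    show ?case
    proof (intro allI impI)
      fix v w
      assume eq: "patterns p {..<n} {..<n} v = patterns p {..<n} {..<n} w"
      show "ba_holds (BEx k \<phi>) v \<longleftrightarrow> ba_holds (BEx k \<phi>) w"
        using imp[OF eq] imp[OF eq[symmetric]] by (rule iffI)
    qed
  qed
qed

end

lemma finite_set_ba_term: "finite (set_ba_term t)"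
  by (induction t) simp_all

lemma finite_set_ba_formula: "finite (set_ba_formula \<phi>)"
  by (induction \<phi>) (simp_all add: finite_set_ba_term)

text \<open>
  Choose tuples satisfying longer and longer finite parts of the type, over an enumeration of its
  parameters. A realization of the limit of their patterns satisfies every formula of the type, since
  each formula only sees a finite pattern.
\<close>

lemma (in perfect_stone_space) limit_patterns_imp_ba_saturated:
  assumes "limit_patterns_realized TYPE('x)"
  shows "ba_countably_saturated TYPE('x clopen)"
  unfolding ba_countably_saturated_def
proof (intro allI impI)
  fix \<Sigma> :: "'x clopen ba_formula set"
  assume count: "countable \<Sigma>"
    and fin: "\<forall>F. finite F \<longrightarrow> F \<subseteq> \<Sigma> \<longrightarrow> (\<exists>v. \<forall>\<phi>\<in>F. ba_holds \<phi> v)"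
  show "\<exists>v. \<forall>\<phi>\<in>\<Sigma>. ba_holds \<phi> v"
  proof (cases "\<Sigma> = {}")
    case False
    define \<phi> where "\<phi> = from_nat_into \<Sigma>"
    have \<phi>: "range \<phi> = \<Sigma>"
      unfolding \<phi>_def by (rule range_from_nat_into[OF False count])
    have "\<exists>v. \<forall>\<psi>\<in>\<phi> ` {..m}. ba_holds \<psi> v" for m
    proof -
      have "finite (\<phi> ` {..m})" "\<phi> ` {..m} \<subseteq> \<Sigma>" using \<phi> by auto
      then show ?thesis using fin by blast
    qed
    then have "\<forall>m. \<exists>v. \<forall>\<psi>\<in>\<phi> ` {..m}. ba_holds \<psi> v" ..
    from choice[OF this] obtain u where "\<forall>m. \<forall>\<psi>\<in>\<phi> ` {..m}. ba_holds \<psi> (u m)" ..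
    then have u: "ba_holds (\<phi> n) (u m)" if "n \<le> m" for n m
      using that by simp
    \<comment> \<open>\<open>bot\<close> is only there to make the set of parameters nonempty, hence enumerable\<close>
    define P where "P = insert bot (\<Union>n. set_ba_formula (\<phi> n))"
    have "countable P"
      unfolding P_def by (simp add: countable_finite finite_set_ba_formula)
    define p where "p = from_nat_into P"
    have p: "range p = P"
      unfolding p_def by (rule range_from_nat_into) (use \<open>countable P\<close> in \<open>simp_all add: P_def\<close>)
    obtain v r where r: "strict_mono r"
      and v: "\<And>n m. n \<le> m \<Longrightarrow> patterns p {..<n} {..<n} v = patterns p {..<n} {..<n} (u (r m))"
      using limit_patterns_realizedE[OF assms, of p u] by metis
    have "ba_holds (\<phi> n) v" for n
    proof -
      have "set_ba_formula (\<phi> n) \<subseteq> range p"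
        unfolding p P_def by blast
      from eventually_happens[OF eventually_conj[OF ba_holds_pattern[OF this] eventually_ge_at_top[of n]]]
      obtain m where m: "\<forall>v w. patterns p {..<m} {..<m} v = patterns p {..<m} {..<m} w \<longrightarrow>
          (ba_holds (\<phi> n) v \<longleftrightarrow> ba_holds (\<phi> n) w)" "n \<le> m"
        by auto
      have "n \<le> r m" using m(2) seq_suble[OF r, of m] by simp
      then show ?thesis using m(1)[rule_format, OF v[OF order_refl]] u by simp
    qed
    then show ?thesis using \<phi> by (intro exI[of _ v]) auto
  qed simp
qed

primrec address_term :: "(nat \<Rightarrow> 'b ba_term) \<Rightarrow> nat set \<Rightarrow> nat \<Rightarrow> 'b ba_term" where
  "address_term u S 0 = BOne"
| "address_term u S (Suc n) =
    BMeet (if n \<in> S then u n else BCompl (u n)) (address_term u S n)"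

lemma mem_address_term:
  "x \<in> Rep_clopen (ba_value (address_term u S n) v)
    \<longleftrightarrow> (\<forall>i<n. i \<in> S \<longleftrightarrow> x \<in> Rep_clopen (ba_value (u i) v))"
  by (induction n) (simp_all add: top_clopen.rep_eq inf_clopen.rep_eq uminus_clopen.rep_eq less_Suc_eq, blast)

lemma mem_address_term_iff:
  "S \<subseteq> {..<n} \<Longrightarrow> x \<in> Rep_clopen (ba_value (address_term u S n) v)
    \<longleftrightarrow> address {..<n} (\<lambda>i. ba_value (u i) v) x = S"
  unfolding mem_address_term address_def by auto

definition pattern_formula ::
    "(nat \<Rightarrow> 'x::topological_space clopen) \<Rightarrow> nat \<Rightarrow> nat set \<Rightarrow> nat set \<Rightarrow> 'x clopen ba_formula" where
  "pattern_formula p n S T =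
    BNot (BEq (BMeet (address_term BVar S n) (address_term (\<lambda>j. BParam (p j)) T n)) BZero)"

lemma ba_holds_pattern_formula:
  assumes "S \<subseteq> {..<n}" "T \<subseteq> {..<n}"
  shows "ba_holds (pattern_formula p n S T) v \<longleftrightarrow> (S, T) \<in> patterns p {..<n} {..<n} v"
proof -
  have "ba_holds (pattern_formula p n S T) v \<longleftrightarrow>
      (\<exists>x. x \<in> Rep_clopen (ba_value (address_term BVar S n) v) \<and>
        x \<in> Rep_clopen (ba_value (address_term (\<lambda>j. BParam (p j)) T n) v))"
    by (simp add: pattern_formula_def Rep_clopen_inject[symmetric] inf_clopen.rep_eq bot_clopen.rep_eq
        disjoint_iff)
  also have "\<dots> \<longleftrightarrow> (\<exists>x. address {..<n} v x = S \<and> address {..<n} p x = T)"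
    by (simp add: mem_address_term_iff[OF assms(1)] mem_address_term_iff[OF assms(2)])
  also have "\<dots> \<longleftrightarrow> (S, T) \<in> patterns p {..<n} {..<n} v"
    by (auto simp: patterns_def image_iff)
  finally show ?thesis .
qed

text \<open>
  Realizing a limit pattern amounts to realizing a countable type of quantifier-free formulas; finitely
  many of these concern levels up to some \<open>M\<close>, and are satisfied by \<open>w M\<close>.
\<close>

lemma ba_saturated_imp_limit_patterns:
  assumes "ba_countably_saturated TYPE('x::topological_space clopen)"
  shows "limit_patterns_realized TYPE('x)"
  unfolding limit_patterns_realized_def
proof (intro allI impI)
  fix p :: "nat \<Rightarrow> 'x clopen" and w
  assume stable: "\<forall>n m. n \<le> m \<longrightarrow> patterns p {..<n} {..<n} (w m) = patterns p {..<n} {..<n} (w n)"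
  define D :: "(nat \<times> nat set \<times> nat set) set" where
    "D = (SIGMA n:UNIV. Pow {..<n} \<times> Pow {..<n})"
  \<comment> \<open>the formula that the limit pattern prescribes for the cell \<open>(S, T)\<close> of level \<open>n\<close>\<close>
  define lit where "lit = (\<lambda>(n, S, T).
    if (S, T) \<in> patterns p {..<n} {..<n} (w n) then pattern_formula p n S T
    else BNot (pattern_formula p n S T))"
  have lit: "ba_holds (lit (n, S, T)) v \<longleftrightarrow>
      ((S, T) \<in> patterns p {..<n} {..<n} v \<longleftrightarrow> (S, T) \<in> patterns p {..<n} {..<n} (w n))"
    if "(n, S, T) \<in> D" for n S T v
  proof -
    have "S \<subseteq> {..<n}" "T \<subseteq> {..<n}" using that by (simp_all add: D_def)
    from ba_holds_pattern_formula[OF this] show ?thesis by (simp add: lit_def)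
  qed
  have "countable D"
    unfolding D_def by (rule countable_SIGMA) (simp_all add: countable_finite)
  then have count: "countable (lit ` D)" by (rule countable_image)
  have fin_sat: "\<exists>v. \<forall>\<phi>\<in>F. ba_holds \<phi> v" if F: "finite F" "F \<subseteq> lit ` D" for F
  proof -
    obtain C where C: "C \<subseteq> D" "finite C" "F = lit ` C"
      using finite_subset_image[OF F] by (elim exE conjE)
    have "finite (fst ` C)" using C(2) by (rule finite_imageI)
    then obtain M where M: "\<forall>n\<in>fst ` C. n \<le> M"
      unfolding finite_nat_set_iff_bounded_le ..
    have "ba_holds (lit c) (w M)" if "c \<in> C" for c
    proof -
      obtain n S T where c: "c = (n, S, T)" by (rule prod_cases3)
      have "n \<in> fst ` C" using that unfolding c by (rule rev_image_eqI) simp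
      with M have "n \<le> M" by (rule bspec)
      from stable[rule_format, OF this]
      have eq: "patterns p {..<n} {..<n} (w M) = patterns p {..<n} {..<n} (w n)" .
      have "(n, S, T) \<in> D" using C(1) that unfolding c by (rule subsetD)
      from lit[OF this, of "w M"] show ?thesis unfolding c eq by simp
    qed
    then show ?thesis unfolding C(3) by blast
  qed
  have "\<exists>v. \<forall>\<phi>\<in>lit ` D. ba_holds \<phi> v"
    by (rule assms[unfolded ba_countably_saturated_def, THEN spec, THEN mp, OF count, THEN mp])
      (intro allI impI fin_sat)
  then obtain v where v: "\<forall>\<phi>\<in>lit ` D. ba_holds \<phi> v" ..
  have "patterns p {..<n} {..<n} v = patterns p {..<n} {..<n} (w n)" for n
  proof (rule set_eqI)
    fix ST
    have sub: "patterns p {..<n} {..<n} u \<subseteq> Pow {..<n} \<times> Pow {..<n}" for u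
      by (auto simp: patterns_def address_def)
    show "ST \<in> patterns p {..<n} {..<n} v \<longleftrightarrow> ST \<in> patterns p {..<n} {..<n} (w n)"
    proof (cases "ST \<in> Pow {..<n} \<times> Pow {..<n}")
      case True
      then have "(n, fst ST, snd ST) \<in> D" by (auto simp: D_def)
      moreover from this have "ba_holds (lit (n, fst ST, snd ST)) v" using v by blast
      ultimately show ?thesis using lit[of n "fst ST" "snd ST" v] by simp
    next
      case False
      then show ?thesis using sub by blast
    qed
  qed
  then show "\<exists>v. \<forall>n. patterns p {..<n} {..<n} v = patterns p {..<n} {..<n} (w n)"
    by (intro exI[of _ v]) simp
qed

section \<open>Bit sequences as codes for points of the unit disk\<close>

text \<open>
  To turn a type of the function algebra into a type of the clopen algebra, functions into the unit
  disk have to be coded by sequences of clopen sets. Binary expansions of the coordinates give a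
  continuous surjection from the Cantor space to a square containing the disk, and nearest-point
  projection maps that square onto the disk. Since every bit sequence is a code, any sequence of
  clopen sets whatsoever codes a continuous function into the disk.
\<close>

definition binary :: "(nat \<Rightarrow> bool) \<Rightarrow> real" where
  "binary z = (\<Sum>l. of_bool (z l) * (1 / 2) ^ Suc l)"

lemma summable_binary: "summable (\<lambda>l. of_bool (z l) * (1 / 2 :: real) ^ Suc l)"
  by (rule summable_comparison_test[where g = "\<lambda>l. (1 / 2) ^ Suc l"])
    (auto intro!: exI[of _ 0] simp: abs_mult summable_geometric)

lemma binary_bounds: "0 \<le> binary z" "binary z \<le> 1"
proof -
  show "0 \<le> binary z"
    unfolding binary_def by (intro suminf_nonneg summable_binary) simp
  have "binary z \<le> (\<Sum>l. (1 / 2) ^ Suc l)"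
    unfolding binary_def
    by (intro suminf_le summable_binary sums_summable[OF power_half_series]) simp
  then show "binary z \<le> 1"
    using sums_unique[OF power_half_series] by simp
qed

lemma binary_split:
  "binary z = (\<Sum>l<k. of_bool (z l) * (1 / 2) ^ Suc l) + (1 / 2) ^ k * binary (\<lambda>l. z (l + k))"
proof -
  have "(1 / 2) ^ k * binary (\<lambda>l. z (l + k))
      = (\<Sum>l. (1 / 2) ^ k * (of_bool (z (l + k)) * (1 / 2) ^ Suc l))"
    unfolding binary_def by (rule suminf_mult[OF summable_binary, symmetric])
  also have "\<dots> = (\<Sum>l. of_bool (z (l + k)) * (1 / 2) ^ Suc (l + k))"
    by (simp add: power_add mult_ac)
  finally show ?thesis
    unfolding binary_def[of z] by (subst suminf_split_initial_segment[OF summable_binary, of _ k]) simp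
qed

lemma binary_prefix:
  assumes "\<And>l. l < k \<Longrightarrow> z l = z' l"
  shows "\<bar>binary z - binary z'\<bar> \<le> (1 / 2) ^ k"
proof -
  have "binary z - binary z' = (1 / 2) ^ k * (binary (\<lambda>l. z (l + k)) - binary (\<lambda>l. z' (l + k)))"
    using assms binary_split[of z k] binary_split[of z' k] by (simp add: right_diff_distrib)
  moreover have "\<bar>binary (\<lambda>l. z (l + k)) - binary (\<lambda>l. z' (l + k))\<bar> \<le> 1"
    using binary_bounds[of "\<lambda>l. z (l + k)"] binary_bounds[of "\<lambda>l. z' (l + k)"] by linarith
  ultimately show ?thesis
    by (simp add: abs_mult mult_left_le)
qed

text \<open>
  The digits are the ones read off by iterating the doubling map \<open>T\<close>.
\<close>

lemma binary_surj:
  assumes "0 \<le> t" "t \<le> 1"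
  obtains z where "binary z = t"
proof -
  define T where "T = rec_nat t (\<lambda>_ s. if s \<ge> 1 / 2 then 2 * s - 1 else 2 * s)"
  have T0: "T 0 = t" and TS: "T (Suc n) = (if T n \<ge> 1 / 2 then 2 * T n - 1 else 2 * T n)" for n
    by (simp_all add: T_def)
  have T: "0 \<le> T n \<and> T n \<le> 1" for n
    by (induction n) (use assms in \<open>auto simp: T0 TS\<close>)
  define z where "z l \<longleftrightarrow> T l \<ge> 1 / 2" for l
  have part: "t = (\<Sum>l<n. of_bool (z l) * (1 / 2) ^ Suc l) + T n * (1 / 2) ^ n" for n
  proof (induction n)
    case (Suc n)
    have "T n * (1 / 2) ^ n = of_bool (z n) * (1 / 2) ^ Suc n + T (Suc n) * (1 / 2) ^ Suc n"
      by (cases "T n \<ge> 1 / 2") (simp_all add: z_def TS field_simps)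
    then show ?case using Suc by simp
  qed (simp add: T0)
  have "(\<lambda>n. T n * (1 / 2) ^ n) \<longlonglongrightarrow> 0"
  proof (rule Lim_null_comparison)
    show "\<forall>\<^sub>F n in sequentially. norm (T n * (1 / 2) ^ n) \<le> (1 / 2) ^ n"
      using T by (intro always_eventually allI) (simp add: abs_mult)
  qed (rule LIMSEQ_power_zero, simp)
  then have "(\<lambda>n. t - T n * (1 / 2) ^ n) \<longlonglongrightarrow> t - 0"
    by (intro tendsto_diff tendsto_const)
  moreover have "(\<lambda>n. t - T n * (1 / 2) ^ n) = (\<lambda>n. \<Sum>l<n. of_bool (z l) * (1 / 2) ^ Suc l)"
    using part by (simp add: fun_eq_iff algebra_simps)
  ultimately have "(\<lambda>l. of_bool (z l) * (1 / 2) ^ Suc l) sums t"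
    by (simp add: sums_def)
  then have "binary z = t" unfolding binary_def by (rule sums_unique[symmetric])
  then show ?thesis by (rule that)
qed

text \<open>
  Even positions hold the real part, odd positions the imaginary part, both rescaled to \<open>[-1, 1]\<close>.
\<close>

definition decode :: "(nat \<Rightarrow> bool) \<Rightarrow> complex" where
  "decode z = closest_point (cball 0 1)
    (Complex (2 * binary (\<lambda>l. z (2 * l)) - 1) (2 * binary (\<lambda>l. z (2 * l + 1)) - 1))"

lemma decode_in_disk: "decode z \<in> cball 0 1"
  unfolding decode_def by (rule closest_point_in_set) auto

text \<open>
  A point of the disk already lies in the square and is fixed by the projection onto the disk.
\<close>

lemma decode_surj:
  assumes "c \<in> cball 0 1"
  obtains z where "decode z = c"
proof -
  have "\<bar>Re c\<bar> \<le> 1" "\<bar>Im c\<bar> \<le> 1"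
    using assms abs_Re_le_cmod[of c] abs_Im_le_cmod[of c] by auto
  then have "0 \<le> (Re c + 1) / 2" "(Re c + 1) / 2 \<le> 1" "0 \<le> (Im c + 1) / 2" "(Im c + 1) / 2 \<le> 1"
    by auto
  then obtain a b where a: "binary a = (Re c + 1) / 2" and b: "binary b = (Im c + 1) / 2"
    by (metis binary_surj)
  define z where "z l = (if even l then a (l div 2) else b (l div 2))" for l
  have "(\<lambda>l. z (2 * l)) = a" "(\<lambda>l. z (2 * l + 1)) = b"
    by (simp_all add: z_def fun_eq_iff)
  then have "decode z = closest_point (cball 0 1) c"
    by (simp add: decode_def a b add_divide_distrib)
  also have "\<dots> = c" using assms by (rule closest_point_self)
  finally show ?thesis by (rule that)
qed

text \<open>
  Uniform continuity of the coding; projecting onto a convex set does not increase distances.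
\<close>

lemma decode_prefix:
  assumes "\<epsilon> > 0"
  obtains k where "\<And>z z'. (\<And>l. l < k \<Longrightarrow> z l = z' l) \<Longrightarrow> dist (decode z) (decode z') < \<epsilon>"
proof -
  obtain k where k: "(1 / 2 :: real) ^ k < \<epsilon> / 4"
    using real_arch_pow_inv[of "\<epsilon> / 4" "1 / 2"] assms by auto
  have "dist (decode z) (decode z') < \<epsilon>" if eq: "\<And>l. l < 2 * k \<Longrightarrow> z l = z' l" for z z'
  proof -
    let ?c = "\<lambda>z. Complex (2 * binary (\<lambda>l. z (2 * l)) - 1) (2 * binary (\<lambda>l. z (2 * l + 1)) - 1)"
    have "dist (decode z) (decode z') \<le> dist (?c z) (?c z')"
      unfolding decode_def by (rule closest_point_lipschitz) auto
    also have "\<dots> \<le> \<bar>Re (?c z - ?c z')\<bar> + \<bar>Im (?c z - ?c z')\<bar>"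
      unfolding dist_norm by (rule cmod_le)
    also have "\<dots> = 2 * \<bar>binary (\<lambda>l. z (2 * l)) - binary (\<lambda>l. z' (2 * l))\<bar>
        + 2 * \<bar>binary (\<lambda>l. z (2 * l + 1)) - binary (\<lambda>l. z' (2 * l + 1))\<bar>"
      by (simp add: abs_if)
    also have "\<dots> \<le> 2 * (1 / 2) ^ k + 2 * (1 / 2) ^ k"
      using binary_prefix[of k "\<lambda>l. z (2 * l)" "\<lambda>l. z' (2 * l)"]
        binary_prefix[of k "\<lambda>l. z (2 * l + 1)" "\<lambda>l. z' (2 * l + 1)"] eq by simp
    also have "\<dots> < \<epsilon>" using k by simp
    finally show ?thesis .
  qed
  then show ?thesis by (rule that)
qed

section \<open>Values of formulas depend continuously on joint ranges\<close>

text \<open>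
  The continuous analogue of equal addresses: \<open>v\<close> at \<open>x\<close> and \<open>w\<close> at \<open>y\<close> have nearly the same first \<open>k\<close>
  coordinates, and the parameters in \<open>P\<close> have nearly the same values at \<open>x\<close> and \<open>y\<close>. One number \<open>k\<close>
  governs both the number of coordinates and the tolerance.
\<close>

definition similar :: "('x::topological_space \<Rightarrow>\<^sub>C complex) set \<Rightarrow> nat \<Rightarrow>
    (nat \<Rightarrow> 'x \<Rightarrow>\<^sub>C complex) \<Rightarrow> 'x \<Rightarrow> (nat \<Rightarrow> 'x \<Rightarrow>\<^sub>C complex) \<Rightarrow> 'x \<Rightarrow> bool" where
  "similar P k v x w y \<longleftrightarrow>
    (\<forall>i<k. dist (apply_bcontfun (v i) x) (apply_bcontfun (w i) y) < 1 / Suc k) \<and>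
    (\<forall>c\<in>P. dist (apply_bcontfun c x) (apply_bcontfun c y) < 1 / Suc k)"

text \<open>
  The joint ranges of \<open>(v, P)\<close> and \<open>(w, P)\<close> have small Hausdorff distance, as far as the first \<open>k\<close>
  coordinates are concerned.
\<close>

definition near :: "('x::topological_space \<Rightarrow>\<^sub>C complex) set \<Rightarrow> nat \<Rightarrow>
    (nat \<Rightarrow> 'x \<Rightarrow>\<^sub>C complex) \<Rightarrow> (nat \<Rightarrow> 'x \<Rightarrow>\<^sub>C complex) \<Rightarrow> bool" where
  "near P k v w \<longleftrightarrow> (\<forall>x. \<exists>y. similar P k v x w y) \<and> (\<forall>y. \<exists>x. similar P k v x w y)"

lemma similar_sym: "similar P k v x w y \<Longrightarrow> similar P k w y v x"
  by (simp add: similar_def dist_commute)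

lemma near_sym: "near P k v w \<Longrightarrow> near P k w v"
  unfolding near_def using similar_sym by blast

lemma inverse_Suc_antimono: "k \<le> k' \<Longrightarrow> 1 / real (Suc k') \<le> 1 / real (Suc k)"
  by (simp add: frac_le)

lemma similar_mono:
  assumes "similar P' k' v x w y" "P \<subseteq> P'" "k \<le> k'"
  shows "similar P k v x w y"
  unfolding similar_def
proof (intro conjI allI impI ballI)
  fix i assume "i < k"
  then have "dist (apply_bcontfun (v i) x) (apply_bcontfun (w i) y) < 1 / Suc k'"
    using assms by (simp add: similar_def)
  with inverse_Suc_antimono[OF assms(3)]
  show "dist (apply_bcontfun (v i) x) (apply_bcontfun (w i) y) < 1 / Suc k" by linarith
next
  fix c assume "c \<in> P"
  then have "dist (apply_bcontfun c x) (apply_bcontfun c y) < 1 / Suc k'"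
    using assms by (auto simp: similar_def)
  with inverse_Suc_antimono[OF assms(3)]
  show "dist (apply_bcontfun c x) (apply_bcontfun c y) < 1 / Suc k" by linarith
qed

lemma near_mono: "near P' k' v w \<Longrightarrow> P \<subseteq> P' \<Longrightarrow> k \<le> k' \<Longrightarrow> near P k v w"
  unfolding near_def using similar_mono[of P' k' v _ w _ P k] by meson

lemma eventually_inverse_Suc_less: "\<epsilon> > 0 \<Longrightarrow> \<forall>\<^sub>F k in sequentially. 1 / real (Suc k) < \<epsilon>"
  using order_tendstoD(2)[OF LIMSEQ_Suc[OF lim_1_over_n], of \<epsilon>] by simp

lemma poly_value_bounded:
  fixes p :: "'a::unital_cstar_algebra star_poly"
  obtains B where "B \<ge> 0" "\<And>v. (\<And>k. v k \<in> cball 0 1) \<Longrightarrow> norm (poly_value p v) \<le> B"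
proof -
  have "\<exists>B\<ge>0. \<forall>v. (\<forall>k. v k \<in> cball 0 1) \<longrightarrow> norm (poly_value p v) \<le> B"
  proof (induction p)
    case (PVar k)
    then show ?case by (intro exI[of _ 1]) simp
  next
    case (PScalar c)
    then show ?case by (intro exI[of _ "norm (scaleC c (1 :: 'a))"]) simp
  next
    case (PParam a)
    then show ?case by (intro exI[of _ "norm a"]) simp
  next
    case (PAdd p q)
    then obtain A B where "\<forall>v. (\<forall>k. v k \<in> cball 0 1) \<longrightarrow> norm (poly_value p v) \<le> A" "A \<ge> 0"
      "\<forall>v. (\<forall>k. v k \<in> cball 0 1) \<longrightarrow> norm (poly_value q v) \<le> B" "B \<ge> 0" by (elim exE conjE) 
    then show ?case
      by (intro exI[of _ "A + B"] conjI allI impI)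
        (simp_all add: add_nonneg_nonneg norm_add_rule_thm order_trans[OF norm_triangle_ineq] add_mono)
  next
    case (PMult p q)
    then obtain A B where "\<forall>v. (\<forall>k. v k \<in> cball 0 1) \<longrightarrow> norm (poly_value p v) \<le> A" "A \<ge> 0"
      "\<forall>v. (\<forall>k. v k \<in> cball 0 1) \<longrightarrow> norm (poly_value q v) \<le> B" "B \<ge> 0" by (elim exE conjE)
    then show ?case
      by (intro exI[of _ "A * B"] conjI allI impI)
        (simp_all add: order_trans[OF norm_mult_ineq] mult_mono)
  next
    case (PAdj p)
    then show ?case by (simp add: norm_adj)
  qed
  then show ?thesis using that by (elim exE conjE) simp
qed

lemma poly_value_local:
  fixes p :: "('x::topological_space \<Rightarrow>\<^sub>C complex) star_poly"
  assumes "poly_params p \<subseteq> P" "\<epsilon> > 0"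
  shows "\<forall>\<^sub>F k in sequentially. \<forall>v w x y.
    (\<forall>i. v i \<in> cball 0 1) \<longrightarrow> (\<forall>i. w i \<in> cball 0 1) \<longrightarrow> similar P k v x w y \<longrightarrow>
    dist (apply_bcontfun (poly_value p v) x) (apply_bcontfun (poly_value p w) y) < \<epsilon>"
  using assms
proof (induction p arbitrary: \<epsilon>)
  case (PVar i)
  from eventually_gt_at_top[of i] eventually_inverse_Suc_less[OF PVar(2)] show ?case
  proof eventually_elim
    case (elim k)
    show ?case
    proof (intro allI impI)
      fix v w x y
      assume "similar P k v x w y"
      then have "dist (apply_bcontfun (v i) x) (apply_bcontfun (w i) y) < 1 / Suc k"
        using elim(1) by (simp add: similar_def)
      then show "dist (apply_bcontfun (poly_value (PVar i) v) x) (apply_bcontfun (poly_value (PVar i) w) y) < \<epsilon>"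
        using elim(2) by simp
    qed
  qed
next
  case (PScalar c)
  then show ?case by simp
next
  case (PParam c)
  from eventually_inverse_Suc_less[OF PParam(2)] show ?case
  proof eventually_elim
    case (elim k)
    show ?case
    proof (intro allI impI)
      fix v w x y
      assume "similar P k v x w y"
      then have "dist (apply_bcontfun c x) (apply_bcontfun c y) < 1 / Suc k"
        using PParam(1) by (simp add: similar_def)
      then show "dist (apply_bcontfun (poly_value (PParam c) v) x) (apply_bcontfun (poly_value (PParam c) w) y) < \<epsilon>"
        using elim by simp
    qed
  qed
next
  case (PAdd p q)
  from PAdd.prems have "poly_params p \<subseteq> P" "poly_params q \<subseteq> P" "\<epsilon> / 2 > 0" by simp_all
  from PAdd.IH(1)[OF this(1,3)] PAdd.IH(2)[OF this(2,3)] show ?case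
  proof eventually_elim
    case (elim k)
    show ?case
    proof (intro allI impI)
      fix v w x y
      assume a: "\<forall>i. v i \<in> cball 0 1" "\<forall>i. w i \<in> cball 0 1" "similar P k v x w y"
      show "dist (apply_bcontfun (poly_value (PAdd p q) v) x) (apply_bcontfun (poly_value (PAdd p q) w) y) < \<epsilon>"
        using dist_triangle_add_half[OF elim(1)[rule_format, OF a(1)[rule_format] a(2)[rule_format] a(3)]
          elim(2)[rule_format, OF a(1)[rule_format] a(2)[rule_format] a(3)]] by simp
    qed
  qed
next
  case (PMult p q)
  obtain A where A: "A \<ge> 0" "\<And>v. (\<And>k. v k \<in> cball 0 1) \<Longrightarrow> norm (poly_value p v) \<le> A"
    by (rule poly_value_bounded[of p]) (rule that, assumption, blast)
  obtain B where B: "B \<ge> 0" "\<And>v. (\<And>k. v k \<in> cball 0 1) \<Longrightarrow> norm (poly_value q v) \<le> B"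
    by (rule poly_value_bounded[of q]) (rule that, assumption, blast)
  define \<eta> where "\<eta> = \<epsilon> / (A + B + 1)"
  have "\<eta> > 0" using A(1) B(1) PMult.prems(2) by (simp add: \<eta>_def)
  from PMult.prems have "poly_params p \<subseteq> P" "poly_params q \<subseteq> P" by simp_all
  from PMult.IH(1)[OF this(1) \<open>\<eta> > 0\<close>] PMult.IH(2)[OF this(2) \<open>\<eta> > 0\<close>] show ?case
  proof eventually_elim
    case (elim k)
    show ?case
    proof (intro allI impI)
      fix v w x y
      assume a: "\<forall>i. v i \<in> cball 0 1" "\<forall>i. w i \<in> cball 0 1" "similar P k v x w y"
      define s s' t t' where st: "s = apply_bcontfun (poly_value p v) x" "s' = apply_bcontfun (poly_value p w) y"
        "t = apply_bcontfun (poly_value q v) x" "t' = apply_bcontfun (poly_value q w) y"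
      have "dist s s' < \<eta>" "dist t t' < \<eta>"
        unfolding st using elim(1)[rule_format, OF a(1)[rule_format] a(2)[rule_format] a(3)]
          elim(2)[rule_format, OF a(1)[rule_format] a(2)[rule_format] a(3)] by simp_all
      moreover have "norm s \<le> A" "norm t' \<le> B"
        unfolding st using order_trans[OF norm_bounded A(2)] order_trans[OF norm_bounded B(2)] a(1,2) by blast+
      moreover have "s * t - s' * t' = s * (t - t') + (s - s') * t'" by (simp add: algebra_simps)
      then have "dist (s * t) (s' * t') \<le> norm s * dist t t' + dist s s' * norm t'"
        unfolding dist_norm by (metis norm_mult norm_triangle_ineq)
      ultimately have "dist (s * t) (s' * t') \<le> A * \<eta> + \<eta> * B"
        using A(1) B(1) \<open>\<eta> > 0\<close>
        by (elim order_trans) (intro add_mono mult_mono, simp_all)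
      also have "\<dots> < (A + B + 1) * \<eta>" using \<open>\<eta> > 0\<close> by (simp add: algebra_simps)
      also have "\<dots> = \<epsilon>" using A(1) B(1) by (simp add: \<eta>_def)
      finally show "dist (apply_bcontfun (poly_value (PMult p q) v) x) (apply_bcontfun (poly_value (PMult p q) w) y) < \<epsilon>"
        by (simp add: st)
    qed
  qed
next
  case (PAdj p)
  then have "poly_params p \<subseteq> P" by simp
  moreover have "dist (cnj a) (cnj b) = dist a b" for a b
    unfolding dist_norm complex_cnj_diff[symmetric] complex_mod_cnj ..
  ultimately show ?case using PAdj by (simp add: adj_complex_def)
qed

text \<open>
  The back-and-forth step for functions. Replace all functions by step functions up to \<open>\<delta>\<close>; points that
  were \<open>\<delta>\<close>-similar then have step values at distance less than \<open>3 \<delta>\<close>. Amalgamation yields a locally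
  constant \<open>h\<close> that assigns to each point on the side of \<open>w\<close> a compatible point on the side of \<open>v\<close>, and
  \<open>a \<circ> h\<close> is the required function. Returning from step functions to the original ones costs \<open>2 \<delta>\<close>
  more, which explains the factor 5.
\<close>

lemma (in perfect_stone_space) near_extend:
  fixes v w :: "nat \<Rightarrow> 'x \<Rightarrow>\<^sub>C complex"
  assumes near: "near P (5 * k + 4) v w" and "finite P" and a: "a \<in> cball 0 1"
  shows "\<exists>b\<in>cball 0 1. near P k (v(j := a)) (w(j := b))"
proof -
  define \<delta> where "\<delta> = 1 / real (Suc (5 * k + 4))"
  have \<delta>: "\<delta> > 0" "5 * \<delta> = 1 / real (Suc k)" by (simp_all add: \<delta>_def field_simps)
  let ?A = "apply_bcontfun :: ('x \<Rightarrow>\<^sub>C complex) \<Rightarrow> _"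
  have retract: "\<exists>f. locally_constant f \<and> (\<forall>i<k. \<forall>x. dist (?A (u i) (f x)) (?A (u i) x) < \<delta>) \<and>
      (\<forall>c\<in>P. \<forall>x. dist (?A c (f x)) (?A c x) < \<delta>) \<and> (\<forall>x. dist (?A a (f x)) (?A a x) < \<delta>)" for u
  proof -
    let ?F = "?A ` (u ` {..<k} \<union> P \<union> {a})"
    have fin: "finite ?F" using \<open>finite P\<close> by simp
    have cont: "continuous_on UNIV g" if "g \<in> ?F" for g using that by (elim imageE) simp
    obtain f :: "'x \<Rightarrow> 'x" where "locally_constant f"
        and f: "\<And>g x. g \<in> ?F \<Longrightarrow> dist (g (f x)) (g x) < \<delta>"
      by (rule locally_constant_retraction[of ?F \<delta>, OF fin cont \<delta>(1)]) (assumption, rule that, assumption, blast)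
    then show ?thesis
      by (intro exI[of _ f] conjI allI impI ballI) (simp_all)
  qed
  obtain f where f: "locally_constant f" "\<forall>i<k. \<forall>x. dist (?A (v i) (f x)) (?A (v i) x) < \<delta>"
      "\<forall>c\<in>P. \<forall>x. dist (?A c (f x)) (?A c x) < \<delta>" "\<forall>x. dist (?A a (f x)) (?A a x) < \<delta>"
    using retract[of v] by (elim exE conjE)
  obtain g where g: "locally_constant g" "\<forall>i<k. \<forall>y. dist (?A (w i) (g y)) (?A (w i) y) < \<delta>"
      "\<forall>c\<in>P. \<forall>y. dist (?A c (g y)) (?A c y) < \<delta>"
    using retract[of w] by (elim exE conjE)
  have tri: "dist p' q' < 3 * \<delta>" if "dist p' p < \<delta>" "dist p q < \<delta>" "dist q' q < \<delta>" for p p' q q' :: complex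
    using that dist_triangle[of p' q' p] dist_triangle[of p q' q] by (simp add: dist_commute)
  define R where "R x y \<longleftrightarrow> (\<forall>i<k. dist (?A (v i) x) (?A (w i) y) < 3 * \<delta>) \<and>
    (\<forall>c\<in>P. dist (?A c x) (?A c y) < 3 * \<delta>)" for x y
  have R: "R (f x) (g y)" if sim: "similar P (5 * k + 4) v x w y" for x y
    unfolding R_def
  proof (intro conjI allI impI ballI)
    fix i assume i: "i < k"
    then have "dist (?A (v i) x) (?A (w i) y) < \<delta>"
      using sim by (simp add: similar_def \<delta>_def)
    then show "dist (?A (v i) (f x)) (?A (w i) (g y)) < 3 * \<delta>"
      by (rule tri[OF f(2)[rule_format, OF i] _ g(2)[rule_format, OF i]])
  next
    fix c assume c: "c \<in> P"
    then have "dist (?A c x) (?A c y) < \<delta>"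
      using sim by (simp add: similar_def \<delta>_def)
    then show "dist (?A c (f x)) (?A c (g y)) < 3 * \<delta>"
      by (rule tri[OF f(3)[rule_format, OF c] _ g(3)[rule_format, OF c]])
  qed
  have total: "\<exists>x. R (f x) (g y)" for y
  proof -
    obtain x where "similar P (5 * k + 4) v x w y" using near unfolding near_def by (elim conjE allE exE)
    from R[OF this] show ?thesis ..
  qed
  obtain h where h: "locally_constant h" "\<And>y. R (h y) (g y)"
      "\<And>x y. R (f x) (g y) \<Longrightarrow> \<exists>y'. g y' = g y \<and> h y' = f x"
    by (rule amalgamation[of f g R, OF f(1) g(1) total]) (rule that, assumption, blast, blast)
  have norm_a: "norm (?A a x) \<le> 1" for x
    using order_trans[OF norm_bounded] a by simp
  define b where "b = Bcontfun (\<lambda>y. ?A a (h y))"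
  have b: "?A b y = ?A a (h y)" for y
    unfolding b_def
    by (subst Bcontfun_inverse) (intro bcontfun_normI[of _ 1] locally_constant_continuous[OF h(1)] norm_a refl)+
  have "norm b \<le> 1" using norm_a by (intro norm_bound) (simp add: b)
  have close: "dist p q < 5 * \<delta>" if "dist p p' < \<delta>" "dist p' q' < 3 * \<delta>" "dist q' q < \<delta>" for p p' q q' :: complex
    using that dist_triangle[of p q p'] dist_triangle[of p' q q'] by simp
  have sim1: "similar P k (v(j := a)) (h y) (w(j := b)) y" for y
    unfolding similar_def
  proof (intro conjI allI impI ballI)
    fix i assume i: "i < k"
    then have "dist (?A (v i) (h y)) (?A (w i) (g y)) < 3 * \<delta>" "dist (?A (w i) (g y)) (?A (w i) y) < \<delta>"
      using h(2)[of y] g(2) by (simp_all add: R_def)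
    from close[OF _ this] have "dist (?A (v i) (h y)) (?A (w i) y) < 5 * \<delta>"
      using \<delta>(1) by simp
    then show "dist (?A ((v(j := a)) i) (h y)) (?A ((w(j := b)) i) y) < 1 / Suc k"
      using \<delta> by (simp add: b)
  next
    fix c assume c: "c \<in> P"
    then have "dist (?A c (h y)) (?A c (g y)) < 3 * \<delta>" "dist (?A c (g y)) (?A c y) < \<delta>"
      using h(2)[of y] g(3) by (simp_all add: R_def)
    from close[OF _ this] have "dist (?A c (h y)) (?A c y) < 5 * \<delta>"
      using \<delta>(1) by simp
    then show "dist (?A c (h y)) (?A c y) < 1 / Suc k"
      using \<delta> by simp
  qed
  have sim2: "\<exists>y. similar P k (v(j := a)) x (w(j := b)) y" for x
  proof -
    obtain y0 where "similar P (5 * k + 4) v x w y0" using near unfolding near_def by (elim conjE allE exE)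
    from h(3)[OF R[OF this]] obtain y where y: "h y = f x" by (elim exE conjE)
    have "similar P k (v(j := a)) x (w(j := b)) y"
      unfolding similar_def
    proof (intro conjI allI impI ballI)
      fix i assume i: "i < k"
      then have "dist (?A (v i) x) (?A (v i) (f x)) < \<delta>" "dist (?A (v i) (f x)) (?A (w i) (g y)) < 3 * \<delta>"
        "dist (?A (w i) (g y)) (?A (w i) y) < \<delta>"
        using h(2)[of y] f(2) g(2) by (simp_all add: R_def y dist_commute)
      then have "dist (?A (v i) x) (?A (w i) y) < 5 * \<delta>" by (rule close)
      moreover have "dist (?A a x) (?A b y) < 5 * \<delta>"
        using f(4)[rule_format, of x] \<delta>(1) by (simp add: b y dist_commute)
      ultimately show "dist (?A ((v(j := a)) i) x) (?A ((w(j := b)) i) y) < 1 / Suc k"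
        using \<delta>(2) by simp
    next
      fix c assume c: "c \<in> P"
      then have "dist (?A c x) (?A c (f x)) < \<delta>" "dist (?A c (f x)) (?A c (g y)) < 3 * \<delta>"
        "dist (?A c (g y)) (?A c y) < \<delta>"
        using h(2)[of y] f(3) g(3) by (simp_all add: R_def y dist_commute)
      then have "dist (?A c x) (?A c y) < 5 * \<delta>" by (rule close)
      then show "dist (?A c x) (?A c y) < 1 / Suc k" using \<delta>(2) by simp
    qed
    then show ?thesis ..
  qed
  have "near P k (v(j := a)) (w(j := b))"
    unfolding near_def by (intro conjI allI sim2) (rule exI, rule sim1)
  then show ?thesis
    using \<open>norm b \<le> 1\<close> by (intro bexI[of _ b]) simp_all
qed

text \<open>
  The arguments of a connective range over a cube in \<open>\<real>\<^sup>n\<close>, padded with zeros. They lie in a compact product of intervals, on which connectives are uniformly continuous.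
\<close>

definition value_box :: "real \<Rightarrow> (nat \<Rightarrow> real) set" where
  "value_box B = {t. \<forall>i. t i \<in> cball 0 B}"

lemma compact_value_box: "compact (value_box B)"
proof -
  have "compactin (product_topology (\<lambda>i::nat. euclidean) UNIV) (PiE UNIV (\<lambda>i. cball (0::real) B))"
    by (subst compactin_PiE) simp
  moreover have "PiE UNIV (\<lambda>i. cball (0::real) B) = value_box B"
    by (auto simp: value_box_def PiE_def)
  ultimately show ?thesis by (simp add: euclidean_product_topology)
qed

lemma uniformly_continuous_value_box:
  fixes f :: "(nat \<Rightarrow> real) \<Rightarrow> real"
  assumes f: "continuous_on UNIV f" and "\<epsilon> > 0"
  obtains d where "d > 0"
    "\<And>s t. s \<in> value_box B \<Longrightarrow> t \<in> value_box B \<Longrightarrow> (\<And>i. dist (s i) (t i) \<le> d) \<Longrightarrow> dist (f s) (f t) < \<epsilon>"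
proof -
  have "uniformly_continuous_on (value_box B) f"
    by (intro compact_uniformly_continuous compact_value_box continuous_on_subset[OF f]) simp
  then obtain e where e: "e > 0"
      "\<And>s t. s \<in> value_box B \<Longrightarrow> t \<in> value_box B \<Longrightarrow> dist t s < e \<Longrightarrow> dist (f t) (f s) < \<epsilon>"
    using \<open>\<epsilon> > 0\<close> by (rule uniformly_continuous_onE) (rule that)
  obtain N where N: "(1 / 2 :: real) ^ N < e / 2"
    using real_arch_pow_inv[of "e / 2" "1 / 2"] e(1) by auto
  have "dist (f s) (f t) < \<epsilon>"
    if st: "s \<in> value_box B" "t \<in> value_box B" and d: "\<And>i. dist (s i) (t i) \<le> e / 4" for s t
  proof -
    have "Max {dist (s (from_nat n)) (t (from_nat n)) | n. n \<le> N} \<le> e / 4"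
    proof (rule Max.boundedI)
      show "finite {dist (s (from_nat n)) (t (from_nat n)) | n. n \<le> N}" by simp
    qed (use d in auto)
    then have "dist s t < e"
      using dist_fun_le_dist_first_terms[of s t N] N by simp
    then show ?thesis using e(2)[OF st(2,1)] by simp
  qed
  then show ?thesis using e(1) by (intro that[of "e / 4"]) simp_all
qed

lemma form_values_in_value_box:
  assumes "\<And>\<psi>. \<psi> \<in> set \<phi>s \<Longrightarrow> \<bar>form_value \<psi> v\<bar> \<le> B" "B \<ge> 0"
  shows "nth_default 0 (map (\<lambda>\<psi>. form_value \<psi> v) \<phi>s) \<in> value_box B"
  using assms by (simp add: value_box_def nth_default_def)

lemma common_bound:
  fixes F :: "'i \<Rightarrow> 'v \<Rightarrow> real"
  assumes "finite S" "\<And>s. s \<in> S \<Longrightarrow> \<exists>B\<ge>0. \<forall>v. Q v \<longrightarrow> \<bar>F s v\<bar> \<le> B"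
  obtains B where "B \<ge> 0" "\<And>s v. s \<in> S \<Longrightarrow> Q v \<Longrightarrow> \<bar>F s v\<bar> \<le> B"
proof -
  have "\<forall>s\<in>S. \<exists>B\<ge>0. \<forall>v. Q v \<longrightarrow> \<bar>F s v\<bar> \<le> B"
    using assms(2) by (rule ballI)
  from bchoice[OF this] obtain b
    where b: "\<forall>s\<in>S. b s \<ge> 0 \<and> (\<forall>v. Q v \<longrightarrow> \<bar>F s v\<bar> \<le> b s)" ..
  let ?B = "Max (insert 0 (b ` S))"
  have fin: "finite (insert 0 (b ` S))" using assms(1) by simp
  show ?thesis
  proof (rule that)
    show "?B \<ge> 0" using fin by (intro Max_ge) simp_all
    fix s v assume s: "s \<in> S" and "Q v"
    then have "\<bar>F s v\<bar> \<le> b s" using b by blast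
    also have "\<dots> \<le> ?B" using fin s by (intro Max_ge) simp_all
    finally show "\<bar>F s v\<bar> \<le> ?B" .
  qed
qed

text \<open>
  Boundedness is needed in two places: it makes the suprema and infima in the semantics genuine, and it
  confines the arguments of connectives to a compact set.
\<close>

lemma form_value_bounded:
  fixes \<phi> :: "'a::unital_cstar_algebra cformula"
  assumes "continuous_connectives \<phi>"
  shows "\<exists>B\<ge>0. \<forall>v. (\<forall>k. v k \<in> cball 0 1) \<longrightarrow> \<bar>form_value \<phi> v\<bar> \<le> B"
  using assms
proof (induction \<phi>)
  case (FNorm p)
  obtain B where B: "B \<ge> 0" "\<And>v. (\<And>k. v k \<in> cball 0 1) \<Longrightarrow> norm (poly_value p v) \<le> B"
    by (rule poly_value_bounded[of p]) (rule that, assumption, blast)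
  then show ?case by (intro exI[of _ B]) simp
next
  case (FConn f \<phi>s)
  have ex: "\<exists>B\<ge>0. \<forall>v. (\<forall>k. v k \<in> cball 0 1) \<longrightarrow> \<bar>form_value \<psi> v\<bar> \<le> B" if "\<psi> \<in> set \<phi>s" for \<psi>
    using FConn.IH[OF that] FConn.prems that by simp
  obtain B where B: "B \<ge> 0"
      "\<And>\<psi> v. \<psi> \<in> set \<phi>s \<Longrightarrow> (\<forall>k. v k \<in> cball 0 1) \<Longrightarrow> \<bar>form_value \<psi> v\<bar> \<le> B"
    by (rule common_bound[of "set \<phi>s" "\<lambda>v. \<forall>k. v k \<in> cball 0 1" form_value, OF finite_set ex])
      (assumption, rule that, assumption, blast)
  have "compact (f ` value_box B)"
    using FConn.prems
    by (intro compact_continuous_image[OF continuous_on_subset[OF _ subset_UNIV]] compact_value_box) simp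
  from compact_imp_bounded[OF this] obtain C where "\<forall>s\<in>f ` value_box B. norm s \<le> C"
    unfolding bounded_iff ..
  then have C: "\<bar>f t\<bar> \<le> C" if "t \<in> value_box B" for t using that by simp
  show ?case
  proof (intro exI[of _ "max 0 C"] conjI allI impI)
    fix v :: "nat \<Rightarrow> 'a" assume v: "\<forall>k. v k \<in> cball 0 1"
    from C[OF form_values_in_value_box[of \<phi>s v B, OF B(2)[OF _ v] B(1)]]
    show "\<bar>form_value (FConn f \<phi>s) v\<bar> \<le> max 0 C" by simp
  qed simp
next
  case (FSup j \<phi>)
  then have "continuous_connectives \<phi>" by simp
  from FSup.IH[OF this] obtain B
    where B: "B \<ge> 0" "\<forall>v. (\<forall>k. v k \<in> cball 0 1) \<longrightarrow> \<bar>form_value \<phi> v\<bar> \<le> B" by (elim exE conjE)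
  show ?case
  proof (intro exI[of _ B] conjI allI impI B(1))
    fix v :: "nat \<Rightarrow> 'a" assume v: "\<forall>k. v k \<in> cball 0 1"
    show "\<bar>form_value (FSup j \<phi>) v\<bar> \<le> B"
      unfolding form_value.simps
    proof (rule cSup_abs_le)
      fix s assume "s \<in> (\<lambda>a. form_value \<phi> (v(j := a))) ` cball 0 1"
      then obtain a where a: "a \<in> cball 0 1" "s = form_value \<phi> (v(j := a))" by blast
      have "\<forall>k. (v(j := a)) k \<in> cball 0 1" using v a(1) by simp
      with B(2) show "\<bar>s\<bar> \<le> B" unfolding a(2) by (elim allE[where x = "v(j := a)"] impE)
    qed simp
  qed
next
  case (FInf j \<phi>)
  then have "continuous_connectives \<phi>" by simp
  from FInf.IH[OF this] obtain B
    where B: "B \<ge> 0" "\<forall>v. (\<forall>k. v k \<in> cball 0 1) \<longrightarrow> \<bar>form_value \<phi> v\<bar> \<le> B" by (elim exE conjE)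
  show ?case
  proof (intro exI[of _ B] conjI allI impI B(1))
    fix v :: "nat \<Rightarrow> 'a" assume v: "\<forall>k. v k \<in> cball 0 1"
    show "\<bar>form_value (FInf j \<phi>) v\<bar> \<le> B"
      unfolding form_value.simps
    proof (rule cInf_abs_ge)
      fix s assume "s \<in> (\<lambda>a. form_value \<phi> (v(j := a))) ` cball 0 1"
      then obtain a where a: "a \<in> cball 0 1" "s = form_value \<phi> (v(j := a))" by blast
      have "\<forall>k. (v(j := a)) k \<in> cball 0 1" using v a(1) by simp
      with B(2) show "\<bar>s\<bar> \<le> B" unfolding a(2) by (elim allE[where x = "v(j := a)"] impE)
    qed simp
  qed
qed

lemma SUP_le_SUP_plus:
  fixes F G :: "'a \<Rightarrow> real"
  assumes "S \<noteq> {}" "bdd_above (G ` S)" "\<And>a. a \<in> S \<Longrightarrow> \<exists>b\<in>S. F a \<le> G b + \<epsilon>"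
  shows "(SUP a\<in>S. F a) \<le> (SUP b\<in>S. G b) + \<epsilon>"
proof (rule cSUP_least[OF assms(1)])
  fix a assume "a \<in> S"
  then obtain b where "b \<in> S" "F a \<le> G b + \<epsilon>" using assms(3) by blast
  moreover have "G b \<le> (SUP b\<in>S. G b)" using \<open>b \<in> S\<close> assms(2) by (rule cSUP_upper)
  ultimately show "F a \<le> (SUP b\<in>S. G b) + \<epsilon>" by simp
qed

lemma INF_le_INF_plus:
  fixes F G :: "'a \<Rightarrow> real"
  assumes "S \<noteq> {}" "bdd_below (F ` S)" "\<And>b. b \<in> S \<Longrightarrow> \<exists>a\<in>S. F a \<le> G b + \<epsilon>"
  shows "(INF a\<in>S. F a) \<le> (INF b\<in>S. G b) + \<epsilon>"
proof -
  have "(INF a\<in>S. F a) - \<epsilon> \<le> (INF b\<in>S. G b)"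
  proof (rule cINF_greatest[OF assms(1)])
    fix b assume "b \<in> S"
    then obtain a where "a \<in> S" "F a \<le> G b + \<epsilon>" using assms(3) by blast
    moreover have "(INF a\<in>S. F a) \<le> F a" using assms(2) \<open>a \<in> S\<close> by (rule cINF_lower)
    ultimately show "(INF a\<in>S. F a) - \<epsilon> \<le> G b" by simp
  qed
  then show ?thesis by simp
qed

lemma poly_value_norm_local:
  fixes p :: "('x::topological_space \<Rightarrow>\<^sub>C complex) star_poly"
  assumes "poly_params p \<subseteq> P" "\<epsilon> > 0"
  shows "\<forall>\<^sub>F k in sequentially. \<forall>v w. (\<forall>i. v i \<in> cball 0 1) \<longrightarrow> (\<forall>i. w i \<in> cball 0 1) \<longrightarrow>
    near P k v w \<longrightarrow> norm (poly_value p v) \<le> norm (poly_value p w) + \<epsilon>"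
  using poly_value_local[OF assms]
proof eventually_elim
  case (elim k)
  show ?case
  proof (intro allI impI norm_bound)
    fix v w x
    assume v: "\<forall>i. v i \<in> cball 0 1" and w: "\<forall>i. w i \<in> cball 0 1" and near: "near P k v w"
    obtain y where "similar P k v x w y" using near unfolding near_def by (elim conjE allE exE)
    with elim v w have "dist (apply_bcontfun (poly_value p v) x) (apply_bcontfun (poly_value p w) y) < \<epsilon>"
      by (elim allE[where x = v] allE[where x = w] allE[where x = x] allE[where x = y] impE)
    then have "norm (apply_bcontfun (poly_value p v) x) \<le> norm (apply_bcontfun (poly_value p w) y) + \<epsilon>"
      using norm_triangle_ineq2[of "apply_bcontfun (poly_value p v) x" "apply_bcontfun (poly_value p w) y"]
      by (simp add: dist_norm)
    also have "norm (apply_bcontfun (poly_value p w) y) \<le> norm (poly_value p w)" by (rule norm_bounded)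
    finally show "norm (apply_bcontfun (poly_value p v) x) \<le> norm (poly_value p w) + \<epsilon>" by simp
  qed
qed

text \<open>
  The analogue of quantifier elimination for the function algebra: the value of a formula depends
  uniformly continuously on the joint range of its variables and parameters. The estimate is stated
  on one side only, because \<open>near\<close> is symmetric; for quantifiers one uses the back-and-forth step.
\<close>

lemma (in perfect_stone_space) form_value_local:
  fixes \<phi> :: "('x \<Rightarrow>\<^sub>C complex) cformula"
  assumes "continuous_connectives \<phi>" "form_params \<phi> \<subseteq> P" "finite P" "\<epsilon> > 0"
  shows "\<forall>\<^sub>F k in sequentially. \<forall>v w. (\<forall>i. v i \<in> cball 0 1) \<longrightarrow> (\<forall>i. w i \<in> cball 0 1) \<longrightarrow>
    near P k v w \<longrightarrow> form_value \<phi> v < form_value \<phi> w + \<epsilon>"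
  using assms
proof (induction \<phi> arbitrary: \<epsilon>)
  case (FNorm p)
  then have "poly_params p \<subseteq> P" "\<epsilon> / 2 > 0" by simp_all
  from poly_value_norm_local[OF this] show ?case
  proof eventually_elim
    case (elim k)
    show ?case
    proof (intro allI impI)
      fix v w
      assume "\<forall>i. v i \<in> cball 0 1" "\<forall>i. w i \<in> cball 0 1" "near P k v w"
      from elim[rule_format, OF this(1)[rule_format] this(2)[rule_format] this(3)] FNorm(4)
      show "form_value (FNorm p) v < form_value (FNorm p) w + \<epsilon>" by simp
    qed
  qed
next
  case (FConn f \<phi>s)
  have f: "continuous_on UNIV f" using FConn.prems(1) by simp
  have cc: "continuous_connectives \<psi>" if "\<psi> \<in> set \<phi>s" for \<psi> using FConn.prems(1) that by simp
  have params: "form_params \<psi> \<subseteq> P" if "\<psi> \<in> set \<phi>s" for \<psi>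
    using FConn.prems(2) that by (simp add: UN_subset_iff)
  obtain B where B: "B \<ge> 0"
      "\<And>\<psi> v. \<psi> \<in> set \<phi>s \<Longrightarrow> (\<forall>k. v k \<in> cball 0 1) \<Longrightarrow> \<bar>form_value \<psi> v\<bar> \<le> B"
    by (rule common_bound[of "set \<phi>s" "\<lambda>v. \<forall>k. v k \<in> cball 0 1" form_value,
          OF finite_set form_value_bounded[OF cc]])
      (assumption, rule that, assumption, blast)
  obtain d where d: "d > 0"
    "\<And>s t. s \<in> value_box B \<Longrightarrow> t \<in> value_box B \<Longrightarrow> (\<And>i. dist (s i) (t i) \<le> d) \<Longrightarrow> dist (f s) (f t) < \<epsilon>"
    by (rule uniformly_continuous_value_box[OF f FConn.prems(4), of B]) (rule that, assumption, blast)
  have "\<forall>\<^sub>F k in sequentially. \<forall>\<psi>\<in>set \<phi>s. \<forall>v w.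
      (\<forall>i. v i \<in> cball 0 1) \<longrightarrow> (\<forall>i. w i \<in> cball 0 1) \<longrightarrow> near P k v w \<longrightarrow>
      form_value \<psi> v < form_value \<psi> w + d"
    using FConn.IH[OF _ cc params FConn.prems(3) d(1)] by (intro eventually_ball_finite) simp_all
  then show ?case
  proof eventually_elim
    case (elim k)
    show ?case
    proof (intro allI impI)
      fix v w
      assume v: "\<forall>i. v i \<in> cball 0 1" and w: "\<forall>i. w i \<in> cball 0 1" and near: "near P k v w"
      let ?t = "\<lambda>u. nth_default 0 (map (\<lambda>\<psi>. form_value \<psi> u) \<phi>s)"
      have "dist (form_value \<psi> v) (form_value \<psi> w) \<le> d" if "\<psi> \<in> set \<phi>s" for \<psi>
        using elim[rule_format, OF that v[rule_format] w[rule_format] near]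
          elim[rule_format, OF that w[rule_format] v[rule_format] near_sym[OF near]]
        by (simp add: dist_real_def abs_le_iff)
      then have "dist (?t v i) (?t w i) \<le> d" for i
        using d(1) by (simp add: nth_default_def)
      then have "dist (f (?t v)) (f (?t w)) < \<epsilon>"
        by (intro d(2) form_values_in_value_box B(1) B(2) v w)
      then show "form_value (FConn f \<phi>s) v < form_value (FConn f \<phi>s) w + \<epsilon>"
        by (simp add: dist_real_def abs_less_iff)
    qed
  qed
next
  case (FSup j \<phi>)
  then have cc: "continuous_connectives \<phi>" "form_params \<phi> \<subseteq> P" "\<epsilon> / 2 > 0" by simp_all
  obtain B where "\<forall>v. (\<forall>k. v k \<in> cball 0 1) \<longrightarrow> \<bar>form_value \<phi> v\<bar> \<le> B"
    using form_value_bounded[OF cc(1)] by (elim exE conjE)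
  then have B: "\<bar>form_value \<phi> v\<bar> \<le> B" if "\<forall>k. v k \<in> cball 0 1" for v using that by simp
  obtain k0 where k0: "\<forall>v w. (\<forall>i. v i \<in> cball 0 1) \<longrightarrow> (\<forall>i. w i \<in> cball 0 1) \<longrightarrow>
      near P k0 v w \<longrightarrow> form_value \<phi> v < form_value \<phi> w + \<epsilon> / 2"
    using eventually_happens[OF FSup.IH[OF cc(1,2) FSup.prems(3) cc(3)]] by (simp, elim exE)
  from eventually_ge_at_top[of "5 * k0 + 4"] show ?case
  proof eventually_elim
    case (elim k)
    show ?case
    proof (intro allI impI)
      fix v w
      assume v: "\<forall>i. v i \<in> cball 0 1" and w: "\<forall>i. w i \<in> cball 0 1" and near: "near P k v w"
      have ball: "\<forall>i. (u(j := a)) i \<in> cball 0 1" if "\<forall>i. u i \<in> cball 0 1" "a \<in> cball 0 1" for u and a :: "'x \<Rightarrow>\<^sub>C complex"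
        using that by simp
      have "(SUP a\<in>cball 0 1. form_value \<phi> (v(j := a))) \<le> (SUP b\<in>cball 0 1. form_value \<phi> (w(j := b))) + \<epsilon> / 2"
      proof (rule SUP_le_SUP_plus)
        show "bdd_above ((\<lambda>b. form_value \<phi> (w(j := b))) ` cball 0 1)"
          by (rule bdd_aboveI2[where M = B]) (rule abs_le_D1[OF B[OF ball[OF w]]])
        fix a :: "'x \<Rightarrow>\<^sub>C complex" assume a: "a \<in> cball 0 1"
        obtain b where b: "b \<in> cball 0 1" "near P k0 (v(j := a)) (w(j := b))"
          using near_extend[OF near_mono[OF near order_refl elim] FSup.prems(3) a] ..
        from k0[rule_format, OF ball[OF v a, rule_format] ball[OF w b(1), rule_format] b(2)]
        show "\<exists>b\<in>cball 0 1. form_value \<phi> (v(j := a)) \<le> form_value \<phi> (w(j := b)) + \<epsilon> / 2"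
          by (intro bexI[OF _ b(1)]) simp
      qed simp
      then show "form_value (FSup j \<phi>) v < form_value (FSup j \<phi>) w + \<epsilon>"
        using FSup.prems(4) by simp
    qed
  qed
next
  case (FInf j \<phi>)
  then have cc: "continuous_connectives \<phi>" "form_params \<phi> \<subseteq> P" "\<epsilon> / 2 > 0" by simp_all
  obtain B where "\<forall>v. (\<forall>k. v k \<in> cball 0 1) \<longrightarrow> \<bar>form_value \<phi> v\<bar> \<le> B"
    using form_value_bounded[OF cc(1)] by (elim exE conjE)
  then have B: "\<bar>form_value \<phi> v\<bar> \<le> B" if "\<forall>k. v k \<in> cball 0 1" for v using that by simp
  obtain k0 where k0: "\<forall>v w. (\<forall>i. v i \<in> cball 0 1) \<longrightarrow> (\<forall>i. w i \<in> cball 0 1) \<longrightarrow>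
      near P k0 v w \<longrightarrow> form_value \<phi> v < form_value \<phi> w + \<epsilon> / 2"
    using eventually_happens[OF FInf.IH[OF cc(1,2) FInf.prems(3) cc(3)]] by (simp, elim exE)
  from eventually_ge_at_top[of "5 * k0 + 4"] show ?case
  proof eventually_elim
    case (elim k)
    show ?case
    proof (intro allI impI)
      fix v w
      assume v: "\<forall>i. v i \<in> cball 0 1" and w: "\<forall>i. w i \<in> cball 0 1" and near: "near P k v w"
      have ball: "\<forall>i. (u(j := a)) i \<in> cball 0 1" if "\<forall>i. u i \<in> cball 0 1" "a \<in> cball 0 1" for u and a :: "'x \<Rightarrow>\<^sub>C complex"
        using that by simp
      have "(INF a\<in>cball 0 1. form_value \<phi> (v(j := a))) \<le> (INF b\<in>cball 0 1. form_value \<phi> (w(j := b))) + \<epsilon> / 2"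
      proof (rule INF_le_INF_plus)
        show "bdd_below ((\<lambda>a. form_value \<phi> (v(j := a))) ` cball 0 1)"
        proof (rule bdd_belowI2[where m = "- B"])
          fix a :: "'x \<Rightarrow>\<^sub>C complex" assume "a \<in> cball 0 1"
          from abs_le_D2[OF B[OF ball[OF v this]]] show "- B \<le> form_value \<phi> (v(j := a))" by linarith
        qed
        fix b :: "'x \<Rightarrow>\<^sub>C complex" assume b: "b \<in> cball 0 1"
        obtain a where a: "a \<in> cball 0 1" "near P k0 (w(j := b)) (v(j := a))"
          using near_extend[OF near_mono[OF near_sym[OF near] order_refl elim] FInf.prems(3) b] ..
        from k0[rule_format, OF ball[OF v a(1), rule_format] ball[OF w b, rule_format] near_sym[OF a(2)]]
        show "\<exists>a\<in>cball 0 1. form_value \<phi> (v(j := a)) \<le> form_value \<phi> (w(j := b)) + \<epsilon> / 2"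
          by (intro bexI[OF _ a(1)]) simp
      qed simp
      then show "form_value (FInf j \<phi>) v < form_value (FInf j \<phi>) w + \<epsilon>"
        using FInf.prems(4) by simp
    qed
  qed
qed

section \<open>Saturation of the function algebra from limit patterns\<close>

lemma continuous_decode:
  fixes Z :: "nat \<Rightarrow> 'x::t2_space clopen"
  shows "continuous_on UNIV (\<lambda>x. decode (\<lambda>l. x \<in> Rep_clopen (Z l)))"
proof (rule continuous_at_imp_continuous_on, rule ballI)
  let ?f = "\<lambda>x. decode (\<lambda>l. x \<in> Rep_clopen (Z l))"
  fix x :: 'x
  have "\<forall>\<^sub>F y in at x. dist (?f y) (?f x) < e" if e: "e > 0" for e
  proof -
    obtain k where k: "\<And>z z'. (\<And>l. l < k \<Longrightarrow> z l = z' l) \<Longrightarrow> dist (decode z) (decode z') < e"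
      by (rule decode_prefix[OF e]) (rule that, blast)
    let ?U = "{y. address {..<k} Z y = address {..<k} Z x}"
    have "open ?U"
      using locally_constant_clopen(1)[OF locally_constant_address[OF finite_lessThan]] .
    moreover have "dist (?f y) (?f x) < e" if "y \<in> ?U" for y
    proof (rule k)
      fix l assume "l < k"
      then show "(y \<in> Rep_clopen (Z l)) = (x \<in> Rep_clopen (Z l))"
        using address_eqD[of "{..<k}" Z y Z x l] that by simp
    qed
    ultimately show ?thesis
      unfolding eventually_at_topological by (intro exI[of _ ?U]) simp
  qed
  then show "isCont ?f x" unfolding isCont_def by (rule tendstoI)
qed

context perfect_stone_space
begin

text \<open>
  Only step functions are coded exactly: a code is chosen for each of the values, and a choice
  that depends on a locally constant function is again locally constant, so the coding sets are clopen.
\<close>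

lemma approximate_code:
  fixes c :: "'x \<Rightarrow>\<^sub>C complex"
  assumes c: "c \<in> cball 0 1" and "\<delta> > 0"
  shows "\<exists>Z. \<forall>x. dist (decode (\<lambda>l. x \<in> Rep_clopen (Z l))) (apply_bcontfun c x) < \<delta>"
proof -
  obtain f :: "'x \<Rightarrow> 'x" where f: "locally_constant f"
      "\<And>u x. u \<in> {apply_bcontfun c} \<Longrightarrow> dist (u (f x)) (u x) < \<delta>"
    by (rule locally_constant_retraction[of "{apply_bcontfun c}" \<delta>]) (simp, simp, rule \<open>\<delta> > 0\<close>, rule that, assumption, blast)
  define code where "code d = (SOME z. decode z = d)" for d
  have code: "decode (code d) = d" if "d \<in> cball 0 1" for d
    unfolding code_def by (rule decode_surj[OF that]) (rule someI[where P = "\<lambda>z. decode z = d"])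
  define Z where "Z l = Abs_clopen {x. code (apply_bcontfun c (f x)) l}" for l
  have "x \<in> Rep_clopen (Z l) \<longleftrightarrow> code (apply_bcontfun c (f x)) l" for x l
    using locally_constant_clopen[OF f(1), of "\<lambda>y. code (apply_bcontfun c y) l"]
    by (simp add: Z_def Abs_clopen_inverse)
  moreover have "apply_bcontfun c x \<in> cball 0 1" for x
    using order_trans[OF norm_bounded[of c x]] c by simp
  ultimately have "decode (\<lambda>l. x \<in> Rep_clopen (Z l)) = apply_bcontfun c (f x)" for x
    by (simp add: code)
  then show ?thesis using f(2) by (intro exI[of _ Z]) simp
qed

text \<open>
  Countably many parameters from the function algebra are replaced by countably many clopen sets: the
  bits of approximate codes of every precision determine the values of the parameters.
\<close>

lemma separating_sequence:
  fixes C :: "('x \<Rightarrow>\<^sub>C complex) set"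
  assumes "countable C" "C \<subseteq> cball 0 1"
  obtains p :: "nat \<Rightarrow> 'x clopen" where
    "\<And>c \<epsilon>. c \<in> C \<Longrightarrow> \<epsilon> > 0 \<Longrightarrow> \<forall>\<^sub>F n in sequentially. \<forall>x y.
      address {..<n} p x = address {..<n} p y \<longrightarrow> dist (apply_bcontfun c x) (apply_bcontfun c y) < \<epsilon>"
proof -
  have "\<forall>c\<in>C. \<exists>Z. \<forall>q x. dist (decode (\<lambda>l. x \<in> Rep_clopen (Z q l))) (apply_bcontfun c x) < 1 / real (Suc q)"
  proof
    fix c assume "c \<in> C"
    then have c: "c \<in> cball 0 1" using assms(2) by blast
    have "\<forall>q. \<exists>Z. \<forall>x. dist (decode (\<lambda>l. x \<in> Rep_clopen (Z l))) (apply_bcontfun c x) < 1 / real (Suc q)"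
      by (intro allI approximate_code[OF c]) simp
    from choice[OF this] show "\<exists>Z. \<forall>q x. dist (decode (\<lambda>l. x \<in> Rep_clopen (Z q l))) (apply_bcontfun c x) < 1 / real (Suc q)" .
  qed
  from bchoice[OF this] obtain Z where Z: "\<forall>c\<in>C. \<forall>q x.
    dist (decode (\<lambda>l. x \<in> Rep_clopen (Z c q l))) (apply_bcontfun c x) < 1 / real (Suc q)" ..
  define A where "A = insert bot (\<Union>c\<in>C. \<Union>q. range (Z c q))"
  have "countable A" unfolding A_def using assms(1) by simp
  define p where "p = from_nat_into A"
  have p: "range p = A"
    unfolding p_def by (rule range_from_nat_into) (use \<open>countable A\<close> in \<open>simp_all add: A_def\<close>)
  show ?thesis
  proof (rule that)
    fix c \<epsilon> assume c: "c \<in> C" and "(\<epsilon> :: real) > 0"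
    then have e3: "\<epsilon> / 3 > 0" by simp
    obtain q where q: "1 / real (Suc q) < \<epsilon> / 3"
      using eventually_happens'[OF sequentially_bot eventually_inverse_Suc_less[OF e3]] ..
    obtain k where k: "\<And>z z'. (\<And>l. l < k \<Longrightarrow> z l = z' l) \<Longrightarrow> dist (decode z) (decode z') < \<epsilon> / 3"
      by (rule decode_prefix[OF e3]) (rule that, blast)
    have "\<forall>\<^sub>F n in sequentially. \<exists>j<n. p j = Z c q l" for l
    proof -
      have "Z c q l \<in> range p" unfolding p A_def using c by blast
      then obtain j where "p j = Z c q l" by (elim rangeE) simp
      then show ?thesis
        using eventually_gt_at_top[of j] by (elim eventually_mono) blast
    qed
    then have "\<forall>\<^sub>F n in sequentially. \<forall>l\<in>{..<k}. \<exists>j<n. p j = Z c q l"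
      by (intro eventually_ball_finite) simp_all
    then show "\<forall>\<^sub>F n in sequentially. \<forall>x y.
      address {..<n} p x = address {..<n} p y \<longrightarrow> dist (apply_bcontfun c x) (apply_bcontfun c y) < \<epsilon>"
    proof eventually_elim
      case (elim n)
      show ?case
      proof (intro allI impI)
        fix x y assume xy: "address {..<n} p x = address {..<n} p y"
        let ?d = "\<lambda>x. decode (\<lambda>l. x \<in> Rep_clopen (Z c q l))"
        have "dist (?d x) (?d y) < \<epsilon> / 3"
        proof (rule k)
          fix l assume "l < k"
          then obtain j where j: "j < n" "p j = Z c q l" using elim by blast
          then show "(x \<in> Rep_clopen (Z c q l)) = (y \<in> Rep_clopen (Z c q l))"
            using address_eqD[OF xy, of j] by simp
        qed
        moreover have "dist (?d x) (apply_bcontfun c x) < \<epsilon> / 3" for x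
          using Z c q by (meson order_less_trans)
        ultimately have "dist (?d x) (?d y) < \<epsilon> / 3" "dist (?d x) (apply_bcontfun c x) < \<epsilon> / 3"
          "dist (?d y) (apply_bcontfun c y) < \<epsilon> / 3"
          by simp_all
        then show "dist (apply_bcontfun c x) (apply_bcontfun c y) < \<epsilon>"
          using dist_triangle[of "apply_bcontfun c x" "apply_bcontfun c y" "?d x"]
            dist_triangle[of "?d x" "apply_bcontfun c y" "?d y"]
          by (simp add: dist_commute)
      qed
    qed
  qed
qed

end

lemma finite_poly_params: "finite (poly_params p)"
  by (induction p) simp_all

lemma finite_form_params: "finite (form_params \<phi>)"
  by (induction \<phi>) (simp_all add: finite_poly_params)

text \<open>
  A compactness property of joint ranges. Code the tuples \<open>u m\<close> with precision tending to 0, pass to a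
  limit of the patterns of the codes over clopen sets separating the parameters, and decode. If two
  points have equal addresses of high level, their codes have long common prefixes, so the decoded values
  are close.
\<close>

lemma (in perfect_stone_space) limit_patterns_realize_limit:
  fixes u :: "nat \<Rightarrow> nat \<Rightarrow> 'x \<Rightarrow>\<^sub>C complex"
  assumes limit: "limit_patterns_realized TYPE('x)"
    and u: "\<And>m i. u m i \<in> cball 0 1" and C: "countable C" "C \<subseteq> cball 0 1"
  obtains b r where "\<forall>i. b i \<in> cball 0 1" "strict_mono r"
    "\<And>Q k. Q \<subseteq> C \<Longrightarrow> finite Q \<Longrightarrow> \<forall>\<^sub>F m in sequentially. near Q k b (u (r m))"
proof -
  obtain p :: "nat \<Rightarrow> 'x clopen" where p: "\<And>c \<epsilon>. c \<in> C \<Longrightarrow> \<epsilon> > 0 \<Longrightarrow> \<forall>\<^sub>F n in sequentially. \<forall>x y.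
      address {..<n} p x = address {..<n} p y \<longrightarrow> dist (apply_bcontfun c x) (apply_bcontfun c y) < \<epsilon>"
    by (rule separating_sequence[OF C]) (rule that, blast)
  have "\<exists>Z. \<forall>x. dist (decode (\<lambda>l. x \<in> Rep_clopen (Z l))) (apply_bcontfun (u m i) x) < 1 / real (Suc m)" for m i
    by (rule approximate_code[OF u]) simp
  then have "\<forall>m. \<forall>i. \<exists>Z. \<forall>x. dist (decode (\<lambda>l. x \<in> Rep_clopen (Z l))) (apply_bcontfun (u m i) x) < 1 / real (Suc m)"
    by (intro allI)
  then have "\<forall>m. \<exists>Z. \<forall>i x. dist (decode (\<lambda>l. x \<in> Rep_clopen (Z i l))) (apply_bcontfun (u m i) x) < 1 / real (Suc m)"
    by (intro allI choice) (elim allE)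
  from choice[OF this] obtain W
    where W: "\<forall>m i x. dist (decode (\<lambda>l. x \<in> Rep_clopen (W m i l))) (apply_bcontfun (u m i) x) < 1 / real (Suc m)" ..
  define w where "w m t = W m (fst (prod_decode t)) (snd (prod_decode t))" for m t
  have w: "w m (prod_encode (i, l)) = W m i l" for m i l by (simp add: w_def)
  obtain v r where r: "strict_mono r" and v: "\<And>n m. n \<le> m \<Longrightarrow>
      patterns p {..<n} {..<n} v = patterns p {..<n} {..<n} (w (r m))"
    by (rule limit_patterns_realizedE[OF limit, of p w]) (rule that, assumption, blast)
  define b where "b i = Bcontfun (\<lambda>x. decode (\<lambda>l. x \<in> Rep_clopen (v (prod_encode (i, l)))))" for i
  have norm_decode: "norm (decode z) \<le> 1" for z using decode_in_disk[of z] by simp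
  have b: "apply_bcontfun (b i) x = decode (\<lambda>l. x \<in> Rep_clopen (v (prod_encode (i, l))))" for i x
    unfolding b_def
    by (subst Bcontfun_inverse) (rule bcontfun_normI[OF continuous_decode norm_decode], rule refl)
  show ?thesis
  proof (rule that)
    have "norm (b i) \<le> 1" for i by (rule norm_bound) (simp add: b norm_decode)
    then show "\<forall>i. b i \<in> cball 0 1" by simp
    show "strict_mono r" by (rule r)
    fix Q k assume Q: "Q \<subseteq> C" "finite Q"
    define \<eta> where "\<eta> = 1 / real (Suc k)"
    have \<eta>: "\<eta> > 0" "\<eta> / 3 > 0" by (simp_all add: \<eta>_def)
    obtain L where L: "\<And>z z'. (\<And>l. l < L \<Longrightarrow> z l = z' l) \<Longrightarrow> dist (decode z) (decode z') < \<eta> / 3"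
      by (rule decode_prefix[OF \<eta>(2)]) (rule that, blast)
    have ev1: "\<forall>\<^sub>F n in sequentially. \<forall>t\<in>prod_encode ` ({..<k} \<times> {..<L}). t < n"
      by (intro eventually_ball_finite ballI eventually_gt_at_top) simp
    have ev2: "\<forall>\<^sub>F n in sequentially. \<forall>c\<in>Q. \<forall>x y. address {..<n} p x = address {..<n} p y \<longrightarrow>
        dist (apply_bcontfun c x) (apply_bcontfun c y) < \<eta>"
      using p[OF subsetD[OF Q(1)] \<eta>(1)] by (intro eventually_ball_finite[OF Q(2)] ballI)
    from ev1 ev2 eventually_inverse_Suc_less[OF \<eta>(2)]
    show "\<forall>\<^sub>F m in sequentially. near Q k b (u (r m))"
    proof eventually_elim
      case (elim m)
      have "1 / real (Suc (r m)) \<le> 1 / real (Suc m)"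
        by (rule inverse_Suc_antimono[OF seq_suble[OF r]])
      then have rm: "1 / real (Suc (r m)) < \<eta> / 3" using elim(3) by simp
      have sim: "similar Q k b x (u (r m)) y"
        if xy: "address {..<m} v x = address {..<m} (w (r m)) y" "address {..<m} p x = address {..<m} p y" for x y
        unfolding similar_def
      proof (intro conjI allI impI ballI)
        fix i assume "i < k"
        have "dist (apply_bcontfun (b i) x) (decode (\<lambda>l. y \<in> Rep_clopen (W (r m) i l))) < \<eta> / 3"
          unfolding b
        proof (rule L)
          fix l assume "l < L"
          then have "prod_encode (i, l) < m" using elim(1) \<open>i < k\<close> by simp
          then show "(x \<in> Rep_clopen (v (prod_encode (i, l)))) = (y \<in> Rep_clopen (W (r m) i l))"
            using address_eqD[OF xy(1), of "prod_encode (i, l)"] by (simp add: w)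
        qed
        moreover have "dist (decode (\<lambda>l. y \<in> Rep_clopen (W (r m) i l))) (apply_bcontfun (u (r m) i) y) < \<eta> / 3"
          using order_less_trans[OF W[rule_format] rm] .
        ultimately have "dist (apply_bcontfun (b i) x) (apply_bcontfun (u (r m) i) y) < \<eta>"
          using dist_triangle[of "apply_bcontfun (b i) x" "apply_bcontfun (u (r m) i) y"
              "decode (\<lambda>l. y \<in> Rep_clopen (W (r m) i l))"] \<eta>(1) by linarith
        then show "dist (apply_bcontfun (b i) x) (apply_bcontfun (u (r m) i) y) < 1 / Suc k"
          by (simp add: \<eta>_def)
      next
        fix c assume "c \<in> Q"
        from elim(2)[rule_format, OF this xy(2)]
        show "dist (apply_bcontfun c x) (apply_bcontfun c y) < 1 / Suc k" by (simp add: \<eta>_def)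
      qed
      have eq: "patterns p {..<m} {..<m} v = patterns p {..<m} {..<m} (w (r m))" by (rule v) simp
      show ?case
        unfolding near_def
      proof (intro conjI allI)
        fix x
        obtain y where "address {..<m} (w (r m)) y = address {..<m} v x" "address {..<m} p y = address {..<m} p x"
          using patterns_eqD[OF eq, of x] by (elim exE conjE)
        from sim[OF this[symmetric]] show "\<exists>y. similar Q k b x (u (r m)) y" ..
      next
        fix y
        obtain x where "address {..<m} v x = address {..<m} (w (r m)) y" "address {..<m} p x = address {..<m} p y"
          using patterns_eqD[OF eq[symmetric], of y] by (elim exE conjE)
        from sim[OF this] show "\<exists>x. similar Q k b x (u (r m)) y" ..
      qed
    qed
  qed
qed

text \<open>
  Take tuples \<open>u m\<close> satisfying the first \<open>m\<close> conditions up to \<open>1 / Suc m\<close>. For the limit tuple \<open>b\<close>, every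
  \<open>\<phi>\<^sub>n(b)\<close> is a limit of values that approach the closed set \<open>K\<^sub>n\<close>.
\<close>

lemma (in perfect_stone_space) limit_patterns_imp_cstar_saturated:
  assumes limit: "limit_patterns_realized TYPE('x)"
  shows "cstar_countably_saturated TYPE('x \<Rightarrow>\<^sub>C complex)"
  unfolding cstar_countably_saturated_def countably_saturated_for_def
proof (intro allI impI iffI)
  fix \<phi> :: "nat \<Rightarrow> ('x \<Rightarrow>\<^sub>C complex) cformula" and K :: "nat \<Rightarrow> real set" and \<epsilon> :: real and \<Delta> :: "nat set"
  assume "\<exists>b. (\<forall>k. b k \<in> cball 0 1) \<and> (\<forall>n. form_value (\<phi> n) b \<in> K n)" "0 < \<epsilon>"
  then show "\<exists>b. (\<forall>k. b k \<in> cball 0 1) \<and> (\<forall>n\<in>\<Delta>. form_value (\<phi> n) b \<in> (\<Union>y\<in>K n. ball y \<epsilon>))"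
    using centre_in_ball by blast
next
  fix \<phi> :: "nat \<Rightarrow> ('x \<Rightarrow>\<^sub>C complex) cformula" and K :: "nat \<Rightarrow> real set"
  assume \<phi>: "\<forall>n. \<phi> n \<in> {\<phi>. continuous_connectives \<phi>} \<and> form_params (\<phi> n) \<subseteq> cball 0 1 \<and> compact (K n)"
    and approx: "\<forall>\<epsilon>>0. \<forall>\<Delta>. finite \<Delta> \<longrightarrow>
      (\<exists>b. (\<forall>k. b k \<in> cball 0 1) \<and> (\<forall>n\<in>\<Delta>. form_value (\<phi> n) b \<in> (\<Union>y\<in>K n. ball y \<epsilon>)))"
  have "\<forall>m. \<exists>b. (\<forall>k. b k \<in> cball 0 1) \<and>
      (\<forall>n\<in>{..m}. form_value (\<phi> n) b \<in> (\<Union>y\<in>K n. ball y (1 / real (Suc m))))"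
    using approx by simp
  from choice[OF this] obtain u where "\<forall>m. (\<forall>k. u m k \<in> cball 0 1) \<and>
      (\<forall>n\<in>{..m}. form_value (\<phi> n) (u m) \<in> (\<Union>y\<in>K n. ball y (1 / real (Suc m))))" ..
  then have u: "u m k \<in> cball 0 1"
    and uK: "n \<le> m \<Longrightarrow> form_value (\<phi> n) (u m) \<in> (\<Union>y\<in>K n. ball y (1 / real (Suc m)))" for m n k
    by blast+
  define C where "C = (\<Union>n. form_params (\<phi> n))"
  have "countable C" "C \<subseteq> cball 0 1"
    unfolding C_def using \<phi> by (simp_all add: countable_finite finite_form_params UN_subset_iff)
  then obtain b r where b: "\<forall>i. b i \<in> cball 0 1" and r: "strict_mono r"
    and near: "\<And>Q k. Q \<subseteq> C \<Longrightarrow> finite Q \<Longrightarrow> \<forall>\<^sub>F m in sequentially. near Q k b (u (r m))"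
    by (rule limit_patterns_realize_limit[of u, OF limit u]) (rule that, assumption, assumption, blast)
  have "form_value (\<phi> n) b \<in> K n" for n
  proof -
    have "closed (K n)" using \<phi> compact_imp_closed by blast
    moreover have "\<exists>y\<in>K n. dist y (form_value (\<phi> n) b) < e" if "e > 0" for e
    proof -
      let ?Q = "form_params (\<phi> n)"
      have e2: "e / 2 > 0" using that by simp
      have "continuous_connectives (\<phi> n)" using \<phi> by simp
      from eventually_happens'[OF sequentially_bot form_value_local[OF this order_refl finite_form_params e2]]
      obtain k where k: "\<forall>v w. (\<forall>i. v i \<in> cball 0 1) \<longrightarrow> (\<forall>i. w i \<in> cball 0 1) \<longrightarrow>
          near ?Q k v w \<longrightarrow> form_value (\<phi> n) v < form_value (\<phi> n) w + e / 2"
        by (elim exE)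
      have "?Q \<subseteq> C" unfolding C_def by blast
      from eventually_happens'[OF sequentially_bot eventually_conj[OF near[OF this finite_form_params, of k]
          eventually_conj[OF eventually_ge_at_top[of n] eventually_inverse_Suc_less[OF e2]]]]
      obtain m where m: "near ?Q k b (u (r m))" "n \<le> m" "1 / real (Suc m) < e / 2"
        by (elim exE conjE)
      have rm: "m \<le> r m" by (rule seq_suble[OF r])
      have "dist (form_value (\<phi> n) b) (form_value (\<phi> n) (u (r m))) < e / 2"
        using k[rule_format, OF b[rule_format] u m(1)] k[rule_format, OF u b[rule_format] near_sym[OF m(1)]]
        unfolding dist_real_def abs_less_iff by linarith
      moreover obtain y where "y \<in> K n" "dist y (form_value (\<phi> n) (u (r m))) < 1 / real (Suc (r m))"
        using uK[OF order_trans[OF m(2) rm]] by auto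
      moreover have "1 / real (Suc (r m)) < e / 2"
        using inverse_Suc_antimono[OF rm] m(3) by simp
      ultimately show ?thesis
        by (intro bexI[of _ y]) (use dist_triangle[of y "form_value (\<phi> n) b" "form_value (\<phi> n) (u (r m))"] in
          \<open>simp_all add: dist_commute\<close>)
    qed
    ultimately show ?thesis using closed_approachable[of "K n"] by blast
  qed
  then show "\<exists>b. (\<forall>k. b k \<in> cball 0 1) \<and> (\<forall>n. form_value (\<phi> n) b \<in> K n)"
    using b by blast
qed

section \<open>Limit patterns from degree-1 saturation\<close>

text \<open>
  Being a projection is not a condition of degree 1, so a clopen set \<open>a\<close> cannot be described directly.
  It is represented by its sign function, with values \<open>1\<close> on \<open>a\<close> and \<open>-1\<close> off \<open>a\<close>, and only extreme
  values are prescribed. For \<open>f\<close> in the unit ball, \<open>1\<^sub>U\<close> the indicator function of \<open>U\<close> and a sign \<open>s\<close>,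
  the norm of \<open>1\<^sub>U (1 + s f)\<close> is \<open>2\<close> iff \<open>f\<close> takes the value \<open>s\<close> on \<open>U\<close>, and \<open>0\<close> iff \<open>f = -s\<close>
  throughout \<open>U\<close>. A solution \<open>f\<close> may have arbitrary values elsewhere in the disk, but any clopen set that
  separates \<open>f = 1\<close> from \<open>f = -1\<close> then does what \<open>a\<close> was meant to do.
\<close>

definition two_valued :: "complex \<Rightarrow> complex \<Rightarrow> 'x::t2_space clopen \<Rightarrow> 'x \<Rightarrow>\<^sub>C complex" where
  "two_valued c d U = Bcontfun (\<lambda>x. if x \<in> Rep_clopen U then c else d)"

lemma two_valued [simp]: "apply_bcontfun (two_valued c d U) x = (if x \<in> Rep_clopen U then c else d)"
proof -
  have "open (Rep_clopen U)" "closed (Rep_clopen U)" using Rep_clopen[of U] by simp_all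
  from locally_constant_continuous[OF locally_constant_mem[OF this], of "\<lambda>b. if b then c else d"]
  have "(\<lambda>x. if x \<in> Rep_clopen U then c else d) \<in> bcontfun"
    by (rule bcontfun_normI[where b = "max (norm c) (norm d)"]) simp
  then show ?thesis unfolding two_valued_def by (simp add: Bcontfun_inverse)
qed

definition hit_poly :: "'x::t2_space clopen \<Rightarrow> complex \<Rightarrow> ('x \<Rightarrow>\<^sub>C complex) star_poly" where
  "hit_poly U s = PAdd (PParam (two_valued 1 0 U))
    (PMult (PMult (PMult (PScalar s) (PParam (two_valued 1 0 U))) (PVar 0)) (PScalar 1))"

lemma hit_poly_degree1: "hit_poly U s \<in> degree1_polys"
  unfolding hit_poly_def by (intro degree1_polys.intros) simp_all

lemma hit_poly_params: "poly_params (hit_poly U s) \<subseteq> cball 0 1"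
proof -
  have "norm (two_valued 1 0 U) \<le> 1" by (rule norm_bound) simp
  then show ?thesis by (simp add: hit_poly_def)
qed

lemma apply_hit_poly:
  "apply_bcontfun (poly_value (hit_poly U s) v) x
    = (if x \<in> Rep_clopen U then 1 + s * apply_bcontfun (v 0) x else 0)"
  by (simp add: hit_poly_def scaleC_complex_def)

lemma norm_hit_poly_zeroD:
  assumes "norm (poly_value (hit_poly U s) v) = 0" "x \<in> Rep_clopen U"
  shows "1 + s * apply_bcontfun (v 0) x = 0"
  using norm_bounded[of "poly_value (hit_poly U s) v" x] assms by (simp add: apply_hit_poly)

lemma norm_hit_poly_gtD:
  assumes "norm (poly_value (hit_poly U s) v) > t" "t \<ge> 0"
  obtains x where "x \<in> Rep_clopen U" "norm (1 + s * apply_bcontfun (v 0) x) > t"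
proof (rule ccontr)
  assume neg: "\<not> thesis"
  have "norm (poly_value (hit_poly U s) v) \<le> t"
  proof (rule norm_bound)
    fix x
    show "norm (apply_bcontfun (poly_value (hit_poly U s) v) x) \<le> t"
    proof (cases "x \<in> Rep_clopen U")
      case True
      then have "\<not> norm (1 + s * apply_bcontfun (v 0) x) > t" using neg that by blast
      then show ?thesis using True by (simp add: apply_hit_poly)
    qed (use assms(2) in \<open>simp add: apply_hit_poly\<close>)
  qed
  then show False using assms(1) by simp
qed

lemma norm_hit_poly_two_valued:
  fixes a U :: "'x::t2_space clopen" and e :: bool
  defines "s \<equiv> if e then 1 else -1"
  shows "norm (poly_value (hit_poly U s) (\<lambda>_. two_valued 1 (-1) a))
    = (if \<exists>x\<in>Rep_clopen U. x \<in> Rep_clopen a \<longleftrightarrow> e then 2 else 0)" (is "norm ?p = _")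
proof -
  have val: "apply_bcontfun ?p x =
      (if x \<in> Rep_clopen U \<and> (x \<in> Rep_clopen a \<longleftrightarrow> e) then 2 else 0)" for x
    by (simp add: apply_hit_poly s_def)
  show ?thesis
  proof (cases "\<exists>x\<in>Rep_clopen U. x \<in> Rep_clopen a \<longleftrightarrow> e")
    case True
    then obtain x where x: "x \<in> Rep_clopen U" "x \<in> Rep_clopen a \<longleftrightarrow> e" by (elim bexE)
    have "norm ?p \<le> 2" by (rule norm_bound) (simp add: val)
    moreover have "2 \<le> norm ?p" using norm_bounded[of ?p x] x by (simp add: val)
    ultimately show ?thesis using True by simp
  next
    case False
    have "apply_bcontfun ?p x = 0" for x using False by (auto simp: val)
    then have "norm ?p \<le> 0" by (intro norm_bound) simp
    then show ?thesis using False by simp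
  qed
qed

lemma Re_gt_of_norm_one_plus:
  fixes z :: complex
  assumes "norm z \<le> 1" "norm (1 + z) > 3 / 2"
  shows "Re z > 1 / 8"
proof -
  have "(3 / 2)\<^sup>2 < (norm (1 + z))\<^sup>2" using assms(2) by (intro power_strict_mono) simp_all
  also have "(norm (1 + z))\<^sup>2 = 1 + 2 * Re z + (norm z)\<^sup>2"
    unfolding cmod_power2 by (simp add: power2_eq_square algebra_simps)
  also have "(norm z)\<^sup>2 \<le> 1" using assms(1) by (simp add: power_le_one)
  finally show ?thesis by (simp add: power2_eq_square)
qed

text \<open>
  This reduces the pattern of \<open>i + 1\<close> variables to conditions on the new set \<open>a\<close> alone: it (\<open>e\<close> true) and
  its complement (\<open>e\<close> false) have to meet certain known cells and to miss the others.
\<close>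

lemma mem_patterns_Suc_iff:
  assumes "S \<subseteq> {..<i}"
  shows "((if e then insert i S else S), T) \<in> patterns p {..<Suc i} J (Z(i := a)) \<longleftrightarrow>
    (\<exists>x. address {..<i} Z x = S \<and> address J p x = T \<and> (x \<in> Rep_clopen a \<longleftrightarrow> e))"
proof -
  have sub: "address {..<i} Z x \<subseteq> {..<i}" for x by (auto simp: address_def)
  have addr: "address {..<Suc i} (Z(i := a)) x
      = (if x \<in> Rep_clopen a then insert i (address {..<i} Z x) else address {..<i} Z x)" for x
    unfolding lessThan_Suc address_fun_upd using sub[of x] by auto
  have "(if e then insert i S else S) = address {..<Suc i} (Z(i := a)) x \<longleftrightarrow>
      address {..<i} Z x = S \<and> (x \<in> Rep_clopen a \<longleftrightarrow> e)" for x
    unfolding addr using sub[of x] assms by (auto split: if_splits)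
  then show ?thesis
    unfolding patterns_def by (auto simp: image_iff)
qed

lemma patterns_Suc_eqI:
  assumes "\<And>S T e. S \<subseteq> {..<i} \<Longrightarrow> T \<subseteq> J \<Longrightarrow>
    ((if e then insert i S else S), T) \<in> patterns p {..<Suc i} J v \<longleftrightarrow>
    ((if e then insert i S else S), T) \<in> patterns p {..<Suc i} J w"
  shows "patterns p {..<Suc i} J v = patterns p {..<Suc i} J w"
proof (rule set_eqI)
  fix ST :: "nat set \<times> nat set"
  have sub: "patterns p {..<Suc i} J u \<subseteq> Pow {..<Suc i} \<times> Pow J" for u
    by (auto simp: patterns_def address_def)
  show "ST \<in> patterns p {..<Suc i} J v \<longleftrightarrow> ST \<in> patterns p {..<Suc i} J w"
  proof (cases "ST \<in> Pow {..<Suc i} \<times> Pow J")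
    case True
    then have "fst ST - {i} \<subseteq> {..<i}" "snd ST \<subseteq> J" by (auto simp: less_Suc_eq)
    moreover have "ST = (if i \<in> fst ST then insert i (fst ST - {i}) else fst ST - {i}, snd ST)"
      by (simp add: prod_eq_iff insert_absorb)
    ultimately show ?thesis using assms[of "fst ST - {i}" "snd ST" "i \<in> fst ST"] by simp
  next
    case False
    then show ?thesis using sub[of v] sub[of w] by blast
  qed
qed

context perfect_stone_space
begin

text \<open>
  If \<open>Z\<close> realizes the limit patterns in the first \<open>i\<close> variables, one more variable can be realized.
  Every requirement on the new set says that it, or its complement, meets or misses a cell that is
  already known; this is the reason for adding variables one at a time, as a requirement on several
  unknown sets at once would be a condition of higher degree. Finitely many requirements are satisfied
  exactly, by the back-and-forth step, and the solution \<open>f\<close> of all of them is turned into a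
  clopen set by rounding the sign of its real part.
\<close>

lemma degree1_saturated_extend:
  fixes p :: "nat \<Rightarrow> 'x clopen"
  assumes sat: "cstar_countably_degree1_saturated TYPE('x \<Rightarrow>\<^sub>C complex)"
    and stable: "\<And>n m. n \<le> m \<Longrightarrow> patterns p {..<n} {..<n} (w m) = patterns p {..<n} {..<n} (w n)"
    and Z: "\<And>n m. i \<le> m \<Longrightarrow> n \<le> m \<Longrightarrow> patterns p {..<i} {..<n} Z = patterns p {..<i} {..<n} (w m)"
  shows "\<exists>a. \<forall>n m. Suc i \<le> m \<longrightarrow> n \<le> m \<longrightarrow>
    patterns p {..<Suc i} {..<n} (Z(i := a)) = patterns p {..<Suc i} {..<n} (w m)"
proof -
  have stable': "patterns p {..<Suc i} {..<n} (w m) = patterns p {..<Suc i} {..<n} (w (max (Suc i) n))"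
    if "Suc i \<le> m" "n \<le> m" for n m
    by (rule patterns_mono[OF stable[of "max (Suc i) n" m]]) (use that in simp_all)
  define cell where "cell n S T = Abs_clopen {x. address {..<i} Z x = S \<and> address {..<n} p x = T}" for n S T
  have cell: "x \<in> Rep_clopen (cell n S T) \<longleftrightarrow> address {..<i} Z x = S \<and> address {..<n} p x = T" for x n S T
  proof -
    have "locally_constant (\<lambda>x. (address {..<i} Z x, address {..<n} p x))"
      by (intro locally_constant_Pair locally_constant_address finite_lessThan)
    from locally_constant_clopen[OF this, of "\<lambda>st. st = (S, T)"]
    show ?thesis by (simp add: cell_def Abs_clopen_inverse)
  qed
  define target where "target n S T e \<longleftrightarrow> S \<subseteq> {..<i} \<and>
    ((if e then insert i S else S), T) \<in> patterns p {..<Suc i} {..<n} (w (max (Suc i) n))" for n S T e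
  define sgn :: "bool \<Rightarrow> complex" where "sgn e = (if e then 1 else -1)" for e
  \<comment> \<open>requirements are numbered through finite sets coded as numbers\<close>
  define idx :: "nat \<Rightarrow> nat \<times> nat \<times> nat \<times> bool" where "idx = from_nat"
  define \<phi> where "\<phi> = (\<lambda>(n, S, T, e). FNorm (hit_poly (cell n (set_decode S) (set_decode T)) (sgn e)))"
  define K where "K = (\<lambda>(n, S, T, e). if target n (set_decode S) (set_decode T) e then {2} else {0 :: real})"
  have legal: "\<phi> (idx j) \<in> FNorm ` degree1_polys \<and> form_params (\<phi> (idx j)) \<subseteq> cball 0 1 \<and> compact (K (idx j))" for j
  proof (cases "idx j")
    case (fields n S T e)
    show ?thesis
      unfolding fields \<phi>_def K_def prod.case cformula.set
      by (intro conjI imageI hit_poly_degree1 hit_poly_params) simp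
  qed
  have approx: "\<exists>b. (\<forall>k. b k \<in> cball 0 1) \<and> (\<forall>j\<in>\<Delta>. form_value (\<phi> (idx j)) b \<in> K (idx j))" if "finite \<Delta>" for \<Delta>
  proof -
    have "finite ((\<lambda>j. fst (idx j)) ` \<Delta>)" using that by (rule finite_imageI)
    then obtain M0 where "\<forall>n\<in>(\<lambda>j. fst (idx j)) ` \<Delta>. n \<le> M0"
      unfolding finite_nat_set_iff_bounded_le ..
    define M where "M = max M0 (Suc i)"
    have M: "Suc i \<le> M" "i \<le> M" by (simp_all add: M_def)
    have M': "fst (idx j) \<le> M" if "j \<in> \<Delta>" for j
      using that \<open>\<forall>n\<in>(\<lambda>j. fst (idx j)) ` \<Delta>. n \<le> M0\<close> by (simp add: M_def le_max_iff_disj)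
    obtain a where "patterns p (insert i {..<i}) {..<M} ((w M)(i := w M i)) = patterns p (insert i {..<i}) {..<M} (Z(i := a))"
      using patterns_extend[OF Z[OF M(2) order_refl, symmetric] finite_lessThan finite_lessThan, of i "w M i"] ..
    then have a: "patterns p {..<Suc i} {..<M} (Z(i := a)) = patterns p {..<Suc i} {..<M} (w M)"
      unfolding fun_upd_triv lessThan_Suc[symmetric] by (rule sym)
    have "form_value (\<phi> (idx j)) (\<lambda>_. two_valued 1 (-1) a) \<in> K (idx j)" if "j \<in> \<Delta>" for j
    proof -
      obtain n S0 T0 e where idx: "idx j = (n, S0, T0, e)" by (rule prod_cases4)
      define S T where "S = set_decode S0" "T = set_decode T0"
      have n: "n \<le> M" using M'[OF that] by (simp add: idx)
      have "patterns p {..<Suc i} {..<n} (Z(i := a)) = patterns p {..<Suc i} {..<n} (w M)"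
        by (rule patterns_mono[OF a]) (use n in simp_all)
      also have "\<dots> = patterns p {..<Suc i} {..<n} (w (max (Suc i) n))"
        by (rule stable'[OF M(1) n])
      finally have pat: "patterns p {..<Suc i} {..<n} (Z(i := a)) = patterns p {..<Suc i} {..<n} (w (max (Suc i) n))" .
      have "(\<exists>x\<in>Rep_clopen (cell n S T). x \<in> Rep_clopen a \<longleftrightarrow> e) \<longleftrightarrow> target n S T e"
      proof (cases "S \<subseteq> {..<i}")
        case True
        have "target n S T e \<longleftrightarrow>
            (\<exists>x. address {..<i} Z x = S \<and> address {..<n} p x = T \<and> (x \<in> Rep_clopen a \<longleftrightarrow> e))"
          unfolding target_def pat[symmetric] mem_patterns_Suc_iff[OF True] using True by simp
        then show ?thesis by (simp add: Bex_def cell)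
      next
        case False
        moreover have "address {..<i} Z x \<subseteq> {..<i}" for x by (auto simp: address_def)
        ultimately have "Rep_clopen (cell n S T) = {}" by (auto simp: set_eq_iff cell)
        then show ?thesis using False by (simp add: target_def)
      qed
      then show ?thesis
        unfolding idx \<phi>_def K_def prod.case form_value.simps sgn_def S_T_def norm_hit_poly_two_valued by simp
    qed
    moreover have "norm (two_valued 1 (-1) a) \<le> 1" by (rule norm_bound) simp
    ultimately show ?thesis by (intro exI[of _ "\<lambda>_. two_valued 1 (-1) a"]) simp
  qed
  have approx': "\<forall>\<epsilon>>0. \<forall>\<Delta>. finite \<Delta> \<longrightarrow> (\<exists>b. (\<forall>k. b k \<in> cball 0 1) \<and>
      (\<forall>j\<in>\<Delta>. form_value (\<phi> (idx j)) b \<in> (\<Union>y\<in>K (idx j). ball y \<epsilon>)))"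
  proof (intro allI impI)
    fix \<epsilon> :: real and \<Delta> :: "nat set" assume "\<epsilon> > 0" "finite \<Delta>"
    from approx[OF this(2)] obtain b where b: "\<forall>k. b k \<in> cball 0 1" "\<forall>j\<in>\<Delta>. form_value (\<phi> (idx j)) b \<in> K (idx j)"
      by (elim exE conjE)
    show "\<exists>b. (\<forall>k. b k \<in> cball 0 1) \<and> (\<forall>j\<in>\<Delta>. form_value (\<phi> (idx j)) b \<in> (\<Union>y\<in>K (idx j). ball y \<epsilon>))"
      by (intro exI[of _ b] conjI b(1) ballI UN_I[OF bspec[OF b(2)]]) (simp_all add: \<open>\<epsilon> > 0\<close>)
  qed
  have "(\<exists>b. (\<forall>k. b k \<in> cball 0 1) \<and> (\<forall>j. form_value (\<phi> (idx j)) b \<in> K (idx j))) \<longleftrightarrow>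
      (\<forall>\<epsilon>>0. \<forall>\<Delta>. finite \<Delta> \<longrightarrow> (\<exists>b. (\<forall>k. b k \<in> cball 0 1) \<and>
        (\<forall>j\<in>\<Delta>. form_value (\<phi> (idx j)) b \<in> (\<Union>y\<in>K (idx j). ball y \<epsilon>))))"
    by (rule sat[unfolded cstar_countably_degree1_saturated_def countably_saturated_for_def, rule_format])
      (rule legal)
  from iffD2[OF this approx']
  obtain b where b: "\<forall>k. b k \<in> cball 0 1" "\<forall>j. form_value (\<phi> (idx j)) b \<in> K (idx j)"
    by (elim exE conjE)
  have bK: "norm (poly_value (hit_poly (cell n S T) (sgn e)) b) = (if target n S T e then 2 else 0)"
    if "finite S" "finite T" for n S T e
  proof -
    define j where "j = to_nat (n, set_encode S, set_encode T, e)"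
    have j: "idx j = (n, set_encode S, set_encode T, e)"
      unfolding idx_def j_def by (rule from_nat_to_nat)
    from b(2)[rule_format, of j] show ?thesis
      unfolding j \<phi>_def K_def prod.case form_value.simps set_encode_inverse[OF that(1)] set_encode_inverse[OF that(2)]
      by (simp split: if_splits)
  qed
  let ?f = "apply_bcontfun (b 0)"
  have f1: "norm (?f x) \<le> 1" for x
    using order_trans[OF norm_bounded[of "b 0" x]] b(1) by simp
  \<comment> \<open>Where \<open>f\<close> nearly attains the sign \<open>s\<close>, \<open>s Re f\<close> exceeds \<open>1 / 8\<close>; hence a step function
    that is \<open>1 / 8\<close>-close to \<open>f\<close> still has the right sign there.\<close>
  obtain g :: "'x \<Rightarrow> 'x" where g: "locally_constant g" "\<And>u x. u \<in> {?f} \<Longrightarrow> dist (u (g x)) (u x) < 1 / 8"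
    by (rule locally_constant_retraction[of "{?f}" "1 / 8"]) (simp, simp, simp, rule that, assumption, blast)
  have Re_g: "Re (?f (g x)) < Re (?f x) + 1 / 8" "Re (?f x) < Re (?f (g x)) + 1 / 8" for x
  proof -
    have "\<bar>Re (?f (g x)) - Re (?f x)\<bar> < 1 / 8"
      using g(2)[of ?f x] abs_Re_le_cmod[of "?f (g x) - ?f x"] by (simp add: dist_norm)
    then show "Re (?f (g x)) < Re (?f x) + 1 / 8" "Re (?f x) < Re (?f (g x)) + 1 / 8" by linarith+
  qed
  define a where "a = Abs_clopen {x. Re (?f (g x)) > 0}"
  have a: "x \<in> Rep_clopen a \<longleftrightarrow> Re (?f (g x)) > 0" for x
    using locally_constant_clopen[OF g(1), of "\<lambda>y. Re (?f y) > 0"] by (simp add: a_def Abs_clopen_inverse)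
  have hits: "(\<exists>x. address {..<i} Z x = S \<and> address {..<n} p x = T \<and> (x \<in> Rep_clopen a \<longleftrightarrow> e)) \<longleftrightarrow> target n S T e"
    if fin: "finite S" "finite T" for n S T e
  proof (cases "target n S T e")
    case True
    then have "norm (poly_value (hit_poly (cell n S T) (sgn e)) b) > 3 / 2" using bK[OF fin] by simp
    then obtain x where x: "x \<in> Rep_clopen (cell n S T)" "norm (1 + sgn e * ?f x) > 3 / 2"
      by (rule norm_hit_poly_gtD) simp
    have "Re (sgn e * ?f x) > 1 / 8"
      by (rule Re_gt_of_norm_one_plus[OF _ x(2)]) (simp add: norm_mult sgn_def f1)
    then have "x \<in> Rep_clopen a \<longleftrightarrow> e"
      unfolding a using Re_g[of x] by (cases e; simp add: sgn_def; linarith)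
    then show ?thesis using True x(1) unfolding cell by blast
  next
    case False
    have "\<not> (x \<in> Rep_clopen a \<longleftrightarrow> e)" if "x \<in> Rep_clopen (cell n S T)" for x
    proof -
      have "norm (poly_value (hit_poly (cell n S T) (sgn e)) b) = 0" using bK[OF fin] False by simp
      from norm_hit_poly_zeroD[OF this that] have "Re (1 + sgn e * ?f x) = 0" by simp
      then show ?thesis
        unfolding a using Re_g[of x] by (cases e; simp add: sgn_def; linarith)
    qed
    then show ?thesis using False unfolding cell by blast
  qed
  have "patterns p {..<Suc i} {..<n} (Z(i := a)) = patterns p {..<Suc i} {..<n} (w m)"
    if "Suc i \<le> m" "n \<le> m" for n m
  proof (rule patterns_Suc_eqI)
    fix S T e assume ST: "S \<subseteq> {..<i}" "T \<subseteq> {..<n}"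
    then have "finite S" "finite T" by (auto intro: finite_subset)
    from hits[OF this, of n e]
    show "((if e then insert i S else S), T) \<in> patterns p {..<Suc i} {..<n} (Z(i := a)) \<longleftrightarrow>
        ((if e then insert i S else S), T) \<in> patterns p {..<Suc i} {..<n} (w m)"
      unfolding mem_patterns_Suc_iff[OF ST(1)] target_def stable'[OF that] using ST(1) by simp
  qed
  then show ?thesis by (intro exI[of _ a]) simp
qed

text \<open>
  The sets of the limit tuple are constructed one after the other, each relative to the earlier ones.
\<close>

lemma degree1_saturated_imp_limit_patterns:
  assumes sat: "cstar_countably_degree1_saturated TYPE('x \<Rightarrow>\<^sub>C complex)"
  shows "limit_patterns_realized TYPE('x)"
  unfolding limit_patterns_realized_def
proof (intro allI impI)
  fix p :: "nat \<Rightarrow> 'x clopen" and w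
  assume "\<forall>n m. n \<le> m \<longrightarrow> patterns p {..<n} {..<n} (w m) = patterns p {..<n} {..<n} (w n)"
  note stable = this[rule_format]
  define inv where "inv i Z \<longleftrightarrow> (\<forall>n m. i \<le> m \<longrightarrow> n \<le> m \<longrightarrow>
    patterns p {..<i} {..<n} Z = patterns p {..<i} {..<n} (w m))" for i Z
  have "\<exists>f. \<forall>i. inv i (f i) \<and> (\<exists>a. f (Suc i) = (f i)(i := a))"
  proof (rule dependent_nat_choice)
    show "\<exists>Z. inv 0 Z"
      unfolding inv_def by (intro exI[of _ "w 0"]) (simp add: patterns_def address_def)
    fix Z i assume "inv i Z"
    have "\<exists>a. inv (Suc i) (Z(i := a))"
      unfolding inv_def
      by (rule degree1_saturated_extend[OF sat], rule stable, assumption)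
        (rule \<open>inv i Z\<close>[unfolded inv_def, rule_format])
    then obtain a where "inv (Suc i) (Z(i := a))" ..
    then show "\<exists>Z'. inv (Suc i) Z' \<and> (\<exists>a. Z' = Z(i := a))"
      by (intro exI[of _ "Z(i := a)"] conjI exI[of _ a] refl)
  qed
  then obtain f where f: "\<forall>i. inv i (f i) \<and> (\<exists>a. f (Suc i) = (f i)(i := a))" ..
  have keep: "f (Suc i + d) i = f (Suc i) i" for i d
  proof (induction d)
    case (Suc d)
    obtain a where "f (Suc (Suc i + d)) = (f (Suc i + d))(Suc i + d := a)"
      using f[rule_format, of "Suc i + d", THEN conjunct2] ..
    then show ?case using Suc by simp
  qed simp
  define v where "v i = f (Suc i) i" for i
  have "patterns p {..<n} {..<n} v = patterns p {..<n} {..<n} (w n)" for n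
  proof -
    have "v i = f n i" if "i \<in> {..<n}" for i
      using keep[of i "n - Suc i"] that by (simp add: v_def)
    then have "patterns p {..<n} {..<n} v = patterns p {..<n} {..<n} (f n)"
      by (rule patterns_cong)
    also have "\<dots> = patterns p {..<n} {..<n} (w n)"
      by (rule f[rule_format, THEN conjunct1, unfolded inv_def, rule_format, OF order_refl order_refl])
    finally show ?thesis .
  qed
  then show "\<exists>v. \<forall>n. patterns p {..<n} {..<n} v = patterns p {..<n} {..<n} (w n)"
    by (intro exI[of _ v] allI)
qed

end

section \<open>The equivalence\<close>

lemma countably_saturated_for_antimono:
  assumes sat: "countably_saturated_for \<Psi>" and sub: "\<Phi> \<subseteq> \<Psi>"
  shows "countably_saturated_for \<Phi>"
  unfolding countably_saturated_for_def
proof (intro allI impI)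
  fix \<phi> :: "nat \<Rightarrow> 'a cformula" and K :: "nat \<Rightarrow> real set"
  assume "\<forall>n. \<phi> n \<in> \<Phi> \<and> form_params (\<phi> n) \<subseteq> cball 0 1 \<and> compact (K n)"
  then have legal: "\<forall>n. \<phi> n \<in> \<Psi> \<and> form_params (\<phi> n) \<subseteq> cball 0 1 \<and> compact (K n)"
    using sub by blast
  show "(\<exists>b. (\<forall>k. b k \<in> cball 0 1) \<and> (\<forall>n. form_value (\<phi> n) b \<in> K n)) \<longleftrightarrow>
      (\<forall>\<epsilon>>0. \<forall>\<Delta>. finite \<Delta> \<longrightarrow> (\<exists>b. (\<forall>k. b k \<in> cball 0 1) \<and>
        (\<forall>n\<in>\<Delta>. form_value (\<phi> n) b \<in> (\<Union>y\<in>K n. ball y \<epsilon>))))"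
    by (rule sat[unfolded countably_saturated_for_def, rule_format]) (rule legal[rule_format])
qed

lemma cstar_saturated_imp_degree1_saturated:
  assumes "cstar_countably_saturated TYPE('a::unital_cstar_algebra)"
  shows "cstar_countably_degree1_saturated TYPE('a)"
  using assms unfolding cstar_countably_saturated_def cstar_countably_degree1_saturated_def
  by (rule countably_saturated_for_antimono) auto

theorem theorem1p4:
  assumes "infinite (UNIV :: 'x::t2_space set)"
    and "compact (UNIV :: 'x set)"
    and "\<exists>\<B> :: 'x set set. topological_basis \<B> \<and> (\<forall>B\<in>\<B>. open B \<and> closed B)"
    and "\<not> (\<exists>x::'x. x isolated_in UNIV)"
  shows "(cstar_countably_degree1_saturated TYPE('x \<Rightarrow>\<^sub>C complex)
      \<longleftrightarrow> cstar_countably_saturated TYPE('x \<Rightarrow>\<^sub>C complex))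
    \<and> (cstar_countably_saturated TYPE('x \<Rightarrow>\<^sub>C complex)
      \<longleftrightarrow> ba_countably_saturated TYPE('x clopen))"
proof -
  interpret perfect_stone_space "TYPE('x)"
    using assms(2-4) by unfold_locales
  let ?D = "cstar_countably_degree1_saturated TYPE('x \<Rightarrow>\<^sub>C complex)"
  let ?S = "cstar_countably_saturated TYPE('x \<Rightarrow>\<^sub>C complex)"
  let ?B = "ba_countably_saturated TYPE('x clopen)"
  let ?L = "limit_patterns_realized TYPE('x)"
  have "?S \<Longrightarrow> ?D" by (rule cstar_saturated_imp_degree1_saturated)
  moreover have "?D \<Longrightarrow> ?L" by (rule degree1_saturated_imp_limit_patterns)
  moreover have "?L \<Longrightarrow> ?B" by (rule limit_patterns_imp_ba_saturated)
  moreover have "?B \<Longrightarrow> ?L" by (rule ba_saturated_imp_limit_patterns)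
  moreover have "?L \<Longrightarrow> ?S" by (rule limit_patterns_imp_cstar_saturated)
  ultimately show ?thesis by iprover
qed

end
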